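(* Let $K$ be a closed polyhedral cone in a finite dimensional real normed space $X$, and let $\Omega_1 := \{x\in K : \|x\|\le 1\}$. Suppose that $(\mathcal{A}_k)_{k}$ is a sequence of compact families of continuous, order-preserving, homogeneous maps $f:K\to K$ that converges to a compact family $\mathcal{A}$ of such maps in the Hausdorff metric on $C(\Omega_1, X)$. Then $r(\mathcal{A}_k)$ converges to $r(\mathcal{A})$, where $r$ denotes the generalized spectral radius.
   Context: A cone in a real normed space is a convex set $K$ with $\lambda K\subseteq K$ for all $\lambda>0$ and $K\cap(-K)=\{0\}$; it is polyhedral if it has a finite number of extreme rays. A closed cone $K$ defines the partial order $x\ge y \iff x-y\in K$. A map $f$ is order-preserving if $f(x)\ge f(y)$ whenever $x\ge y$, and homogeneous if $f(cx)=cf(x)$ for all $c>0$. For a homogeneous map $f$ on a non-zero cone $K$, $\|f\| := \sup\{\|f(x)\| : x\in K, \|x\|=1\}$. For bounded (i.e. $\|f\|<\infty$) homogeneous $f:K\to K$, the cone spectral radius is $r(f):=\lim_{n\to\infty}\|f^n\|^{1/n}=\inf_{n>0}\|f^n\|^{1/n}$. For a family $\mathcal{A}$ and $m\ge1$, $\mathcal{A}^m:=\{f_m\circ\cdots\circ f_1 : f_i\in\mathcal{A}\}$, and for a bounded family (one with $\{\|f\|:f\in\mathcal{A}\}$ bounded) the generalized spectral radius is $r(\mathcal{A}):=\limsup_{m\to\infty}\sup_{f\in\mathcal{A}^m}r(f)^{1/m}=\sup_{m>0}\sup_{f\in\mathcal{A}^m}r(f)^{1/m}$. $C(\Omega_1,X)$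 is the Banach space of continuous functions $\Omega_1\to X$ with the supremum norm. Each continuous homogeneous map $f:K\to K$ is identified with its restriction to $\Omega_1$ (which determines it by homogeneity); a family is compact if it is compact as a subset of $C(\Omega_1,X)$, and the Hausdorff metric is the one on nonempty compact subsets of $C(\Omega_1,X)$. *)

theory Defs
  imports "HOL-Analysis.Analysis"
begin

text \<open>Pointed convex cones in a real normed space. (The library predicate \<open>cone\<close> requires neither
  convexity nor pointedness.)\<close>

definition is_cone :: "'a::real_normed_vector set \<Rightarrow> bool" where
  "is_cone K \<longleftrightarrow>
     convex K \<and> (\<forall>c>0. (\<lambda>x. c *\<^sub>R x) ` K \<subseteq> K) \<and> K \<inter> uminus ` K = {0}"

text \<open>An extreme ray of \<open>K\<close> is a half-line from the origin that is a face of \<open>K\<close>.\<close>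

definition extreme_ray :: "'a::real_normed_vector set \<Rightarrow> 'a set \<Rightarrow> bool" where
  "extreme_ray K R \<longleftrightarrow> R face_of K \<and> (\<exists>x. x \<noteq> 0 \<and> R = {c *\<^sub>R x | c. 0 \<le> c})"

definition polyhedral_cone :: "'a::real_normed_vector set \<Rightarrow> bool" where
  "polyhedral_cone K \<longleftrightarrow> is_cone K \<and> finite {R. extreme_ray K R}"

definition cone_le :: "'a::real_normed_vector set \<Rightarrow> 'a \<Rightarrow> 'a \<Rightarrow> bool" where
  "cone_le K y x \<longleftrightarrow> x - y \<in> K"

definition order_preserving_on :: "'a::real_normed_vector set \<Rightarrow> ('a \<Rightarrow> 'a) \<Rightarrow> bool" where
  "order_preserving_on K f \<longleftrightarrow> (\<forall>x\<in>K. \<forall>y\<in>K. cone_le K y x \<longrightarrow> cone_le K (f y) (f x))"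

definition homogeneous_on :: "'a::real_normed_vector set \<Rightarrow> ('a \<Rightarrow> 'a) \<Rightarrow> bool" where
  "homogeneous_on K f \<longleftrightarrow> (\<forall>x\<in>K. \<forall>c>0. f (c *\<^sub>R x) = c *\<^sub>R f x)"

text \<open>A map \<open>K \<rightarrow> K\<close> is represented by a total function whose values outside \<open>K\<close> are
  irrelevant: all notions below depend only on its values on \<open>K\<close>.\<close>

definition cone_maps :: "'a::real_normed_vector set \<Rightarrow> ('a \<Rightarrow> 'a) set" where
  "cone_maps K =
     {f. f \<in> K \<rightarrow> K \<and> continuous_on K f \<and> order_preserving_on K f \<and> homogeneous_on K f}"

text \<open>The following supremum is taken in the reals, so it is meaningful for bounded maps on a
  non-zero cone. For \<open>K = {0}\<close> it is the unspecified constant \<open>Sup {}\<close>, whatever the map.\<close>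

definition cone_norm :: "'a::real_normed_vector set \<Rightarrow> ('a \<Rightarrow> 'a) \<Rightarrow> real" where
  "cone_norm K f = (SUP x\<in>{x \<in> K. norm x = 1}. norm (f x))"

definition cone_spectral_radius :: "'a::real_normed_vector set \<Rightarrow> ('a \<Rightarrow> 'a) \<Rightarrow> real" where
  "cone_spectral_radius K f = lim (\<lambda>n. root n (cone_norm K (f ^^ n)))"

text \<open>The list \<open>[f\<^sub>m, \<dots>, f\<^sub>1]\<close> stands for the composition of \<open>f\<^sub>m\<close> through \<open>f\<^sub>1\<close>, with \<open>f\<^sub>1\<close> applied
  first.\<close>

definition family_power :: "('a \<Rightarrow> 'a) set \<Rightarrow> nat \<Rightarrow> ('a \<Rightarrow> 'a) set" where
  "family_power A m = {foldr (\<circ>) fs id | fs. length fs = m \<and> set fs \<subseteq> A}"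

text \<open>The upper limit is taken in the extended reals, where it always exists.\<close>

definition generalized_spectral_radius ::
    "'a::real_normed_vector set \<Rightarrow> ('a \<Rightarrow> 'a) set \<Rightarrow> ereal" where
  "generalized_spectral_radius K A =
     limsup (\<lambda>m. SUP f\<in>family_power A m. ereal (root m (cone_spectral_radius K f)))"

definition cone_ball :: "'a::real_normed_vector set \<Rightarrow> 'a set" where
  "cone_ball K = {x \<in> K. norm x \<le> 1}"

text \<open>The library space of bounded continuous functions with the supremum metric; its elements
  are extensional functions. When the unit part of \<open>K\<close> is compact, all continuous
  functions on it are bounded.\<close>

definition C_metric :: "'a::real_normed_vector set \<Rightarrow> ('a \<Rightarrow> 'a) metric" where
  "C_metric K = cfunspace (top_of_set (cone_ball K)) euclidean_metric"

definition restrict_family ::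
    "'a::real_normed_vector set \<Rightarrow> ('a \<Rightarrow> 'a) set \<Rightarrow> ('a \<Rightarrow> 'a) set" where
  "restrict_family K A = (\<lambda>f. restrict f (cone_ball K)) ` A"

definition compact_family :: "'a::real_normed_vector set \<Rightarrow> ('a \<Rightarrow> 'a) set \<Rightarrow> bool" where
  "compact_family K A \<longleftrightarrow> compactin (mtopology_of (C_metric K)) (restrict_family K A)"

text \<open>The Hausdorff distance; meaningful for nonempty compact sets of the metric space.\<close>

definition hausdorff_distance :: "'b metric \<Rightarrow> 'b set \<Rightarrow> 'b set \<Rightarrow> real" where
  "hausdorff_distance M S T =
     max (SUP s\<in>S. INF t\<in>T. mdist M s t) (SUP t\<in>T. INF s\<in>S. mdist M s t)"

end

theory Submission
  imports Defs
begin

text \<open>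
  For a family \<open>A\<close> two growth rates are compared: the generalized spectral radius, which is built from
  the spectral radii of single compositions, and the rate at which the norms of all compositions of
  length \<open>n\<close> grow with \<open>n\<close>. A strict upper bound for the norms at one fixed length survives small
  perturbations of the family, so the second rate is upper semicontinuous. A lower bound for the first
  rate is certified by a composition \<open>g\<close> of length \<open>n\<close> and a vector \<open>p \<noteq> 0\<close> of the cone with
  \<open>g p \<ge> c ^ n *\<^sub>R p\<close>, because iterating \<open>g\<close> on \<open>p\<close> then produces growth at rate \<open>c\<close>. In a polyhedral cone
  such certificates survive small perturbations as well. Continuity follows once the two rates are
  known to agree.

  Polyhedrality enters through \<open>order_lower_semicontinuous\<close>: if \<open>x \<in> K\<close> and \<open>c < 1\<close>, then all points of
  \<open>K\<close> close to \<open>x\<close> dominate \<open>c *\<^sub>R x\<close>. It is proved from the generation of \<open>K\<close> by its extreme rays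
  (\<open>extreme_rays_generate\<close>). The space is merely normed, so compactness of bounded closed sets and
  Minkowski's theorem for cones are derived directly from the finite spanning set.

  That the two rates agree is the content of \<open>growth_realized\<close>, a nonlinear substitute for the
  Berger--Wang theorem. Suppose that the norms of compositions grow at least at rate \<open>l\<close>. Call a unit
  vector persistent if it starts trajectories that stay above rate \<open>l\<close> for arbitrarily long times.
  The persistent vectors form a nonempty compact set, since away from them trajectories lose against
  rate \<open>l\<close> uniformly (\<open>decay_off_persistent\<close>), and for the same reason a persistent vector has a
  trajectory that comes back close to this set while its norm has kept up with rate \<open>l\<close>
  (\<open>return_near_persistent_core\<close>). Covering the set by finitely many neighbourhoods in which points
  dominate almost all of their centre turns these returns into a finite directed graph in which every
  vertex has a successor. A cycle in this graph yields a composition \<open>g\<close> with \<open>g p \<ge> c ^ n *\<^sub>R p\<close>, where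
  \<open>c\<close> is as close to \<open>l\<close> as desired.
\<close>

section \<open>Compactness in finite dimension\<close>

text \<open>In a space without an inner product the coefficient of a new vector \<open>a\<close> is controlled by the
distance from \<open>a\<close> to the span of the old ones, which is positive because that span is closed by
the induction hypothesis.\<close>

lemma bounded_seq_in_finite_span:
  fixes X :: "nat \<Rightarrow> 'a::real_normed_vector"
  assumes "finite S" "bounded (range X)" "range X \<subseteq> span S"
  shows "\<exists>l r. l \<in> span S \<and> strict_mono r \<and> (X \<circ> r) \<longlonglongrightarrow> l"
  using assms
proof (induction S arbitrary: X rule: finite_induct)
  case empty
  then have "X = (\<lambda>n. 0)" by auto
  then show ?case
    by (intro exI[of _ 0] exI[of _ id]) (auto simp: strict_mono_def o_def)
next
  case (insert a S)
  show ?case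
  proof (cases "a \<in> span S")
    case True
    then have "span (insert a S) = span S" by (simp add: span_redundant)
    then show ?thesis using insert by metis
  next
    case False
    have "closed (span S)"
      unfolding closed_sequential_limits
    proof (intro allI impI)
      fix x l assume x: "(\<forall>n. x n \<in> span S) \<and> x \<longlonglongrightarrow> l"
      then have "bounded (range x)" by (meson convergent_imp_bounded)
      with x insert.IH[of x] obtain l' r where "l' \<in> span S" "strict_mono r" "(x \<circ> r) \<longlonglongrightarrow> l'"
        by blast
      moreover have "(x \<circ> r) \<longlonglongrightarrow> l" using x \<open>strict_mono r\<close> LIMSEQ_subseq_LIMSEQ by blast
      ultimately show "l \<in> span S" using LIMSEQ_unique by blast
    qed
    then have d: "infdist a (span S) > 0"
      using False span_zero by (intro infdist_pos_not_in_closed) auto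
    have "\<exists>t. X n - t *\<^sub>R a \<in> span S" for n
      using insert.prems(2) by (intro span_breakdown_eq[THEN iffD1]) auto
    then obtain t where t: "\<And>n. X n - t n *\<^sub>R a \<in> span S" by metis
    define Y where "Y = (\<lambda>n. X n - t n *\<^sub>R a)"
    obtain M where M: "\<And>n. norm (X n) \<le> M"
      using insert.prems(1) unfolding bounded_iff by auto
    have lower: "\<bar>t n\<bar> * infdist a (span S) \<le> norm (X n)" for n
    proof (cases "t n = 0")
      case False
      have "- (Y n /\<^sub>R t n) \<in> span S"
        using t Y_def by (intro span_neg span_scale) auto
      then have "infdist a (span S) \<le> dist a (- (Y n /\<^sub>R t n))" by (rule infdist_le)
      also have "\<dots> = norm (a + Y n /\<^sub>R t n)" by (simp add: dist_norm)
      finally have "\<bar>t n\<bar> * infdist a (span S) \<le> norm (t n *\<^sub>R (a + Y n /\<^sub>R t n))"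
        by (simp add: mult_left_mono)
      also have "t n *\<^sub>R (a + Y n /\<^sub>R t n) = X n"
        using False by (simp add: Y_def scaleR_add_right)
      finally show ?thesis .
    qed simp
    have tb: "\<bar>t n\<bar> \<le> M / infdist a (span S)" for n
      using order_trans[OF lower M] d by (simp add: pos_le_divide_eq)
    then have "bounded (range t)" unfolding bounded_iff by auto
    then obtain t0 r1 where r1: "strict_mono r1" "(t \<circ> r1) \<longlonglongrightarrow> t0"
      using bounded_imp_convergent_subsequence by blast
    have "norm (Y n) \<le> M + M / infdist a (span S) * norm a" for n
    proof -
      have "norm (Y n) \<le> norm (X n) + norm (t n *\<^sub>R a)"
        unfolding Y_def by (rule norm_triangle_ineq4)
      then show ?thesis using M[of n] mult_right_mono[OF tb[of n], of "norm a"] by simp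
    qed
    then have "bounded (range (Y \<circ> r1))" unfolding bounded_iff by auto
    moreover have "range (Y \<circ> r1) \<subseteq> span S" using t Y_def by auto
    ultimately obtain y r2 where r2: "y \<in> span S" "strict_mono r2" "(Y \<circ> r1 \<circ> r2) \<longlonglongrightarrow> y"
      using insert.IH by blast
    have "(t \<circ> r1 \<circ> r2) \<longlonglongrightarrow> t0" using r1 r2 LIMSEQ_subseq_LIMSEQ by blast
    then have "(\<lambda>n. (t \<circ> r1 \<circ> r2) n *\<^sub>R a + (Y \<circ> r1 \<circ> r2) n) \<longlonglongrightarrow> t0 *\<^sub>R a + y"
      using r2(3) by (intro tendsto_intros)
    moreover have "(\<lambda>n. (t \<circ> r1 \<circ> r2) n *\<^sub>R a + (Y \<circ> r1 \<circ> r2) n) = X \<circ> (r1 \<circ> r2)"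
      by (auto simp: Y_def)
    moreover have "t0 *\<^sub>R a + y \<in> span (insert a S)"
      using r2(1) by (intro span_add span_scale) (auto intro: span_base span_mono[THEN subsetD, of S])
    ultimately show ?thesis using r1 r2 strict_mono_o by metis
  qed
qed

section \<open>Closed cones in finite dimension\<close>

locale closed_cone =
  fixes K :: "'a::real_normed_vector set"
  assumes fin_dim: "\<exists>S::'a set. finite S \<and> span S = UNIV"
    and cone: "is_cone K" and closed_K: "closed K"
begin

abbreviation unit_part :: "'a set"
  where "unit_part \<equiv> {x \<in> K. norm x = 1}"

lemma zero_in: "0 \<in> K"
  using cone unfolding is_cone_def by auto

lemma scale_in: "x \<in> K \<Longrightarrow> 0 \<le> c \<Longrightarrow> c *\<^sub>R x \<in> K"
  using cone zero_in unfolding is_cone_def by (cases "c = 0") (auto simp: image_subset_iff)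

lemma add_in:
  assumes "x \<in> K" "y \<in> K" shows "x + y \<in> K"
proof -
  have "(1/2) *\<^sub>R x + (1/2) *\<^sub>R y \<in> K"
    using cone assms unfolding is_cone_def by (intro convexD) auto
  from scale_in[OF this, of 2] show ?thesis by (simp add: scaleR_add_right)
qed

lemma pointed: "x \<in> K \<Longrightarrow> - x \<in> K \<Longrightarrow> x = 0"
  using cone unfolding is_cone_def by (auto simp: image_iff) (metis IntI imageI minus_minus singletonD)

lemma diff_scale_trans:
  assumes "y - c *\<^sub>R x \<in> K" "z - d *\<^sub>R y \<in> K" "0 \<le> d"
  shows "z - (d * c) *\<^sub>R x \<in> K"
  using add_in[OF assms(2) scale_in[OF assms(1,3)]] by (simp add: algebra_simps)

lemma diff_scale_weaken:
  assumes "y - c *\<^sub>R x \<in> K" "d \<le> c" "x \<in> K"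
  shows "y - d *\<^sub>R x \<in> K"
  using add_in[OF assms(1) scale_in[OF assms(3), of "c - d"]] assms(2) by (simp add: algebra_simps)

lemma bounded_seq_subseq:
  fixes X :: "nat \<Rightarrow> 'a"
  assumes "bounded (range X)"
  shows "\<exists>l r. strict_mono r \<and> (X \<circ> r) \<longlonglongrightarrow> l"
proof -
  obtain S :: "'a set" where "finite S" "span S = UNIV" using fin_dim by blast
  then show ?thesis using bounded_seq_in_finite_span[of S X] assms by auto
qed

lemma compact_unit_part: "compact unit_part"
  unfolding compact_def
proof (intro allI impI)
  fix X :: "nat \<Rightarrow> 'a" assume X: "\<forall>n. X n \<in> unit_part"
  then have "bounded (range X)" unfolding bounded_iff by (intro exI[of _ 1]) auto
  then obtain l r where lr: "strict_mono r" "(X \<circ> r) \<longlonglongrightarrow> l" using bounded_seq_subseq by blast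
  have "l \<in> K"
    using closed_K lr(2) X unfolding closed_sequential_limits by (metis (mono_tags, lifting) comp_apply mem_Collect_eq)
  moreover have "norm l = 1"
  proof -
    have "(\<lambda>n. norm ((X \<circ> r) n)) \<longlonglongrightarrow> norm l" using lr(2) by (rule tendsto_norm)
    moreover have "(\<lambda>n. norm ((X \<circ> r) n)) = (\<lambda>n. 1)" using X by auto
    ultimately show ?thesis by (simp add: LIMSEQ_const_iff)
  qed
  ultimately show "\<exists>l\<in>unit_part. \<exists>r. strict_mono r \<and> (X \<circ> r) \<longlonglongrightarrow> l" using lr by blast
qed

lemma direction_in_unit_part: "x \<in> K \<Longrightarrow> x \<noteq> 0 \<Longrightarrow> x /\<^sub>R norm x \<in> unit_part"
  using scale_in[of x "inverse (norm x)"] by auto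

text \<open>Normality of the order: a counterexample sequence, normalized, would converge to a unit vector
whose negative also lies in \<open>K\<close>.\<close>

lemma normality: "\<exists>M>0. \<forall>x y. x \<in> K \<and> y - x \<in> K \<longrightarrow> norm x \<le> M * norm y"
proof (rule ccontr)
  assume "\<not> ?thesis"
  then have "\<forall>n. \<exists>x y. x \<in> K \<and> y - x \<in> K \<and> norm x > real (Suc n) * norm y"
    by (metis not_le of_nat_0_less_iff zero_less_Suc)
  then obtain x y where xy: "\<And>n. x n \<in> K" "\<And>n. y n - x n \<in> K" "\<And>n. norm (x n) > real (Suc n) * norm (y n)"
    by metis
  have x0: "norm (x n) > 0" for n
    using xy(3)[of n] by (metis mult_nonneg_nonneg norm_ge_zero of_nat_0_le_iff order.strict_trans1)
  define u v where "u = (\<lambda>n. x n /\<^sub>R norm (x n))" and "v = (\<lambda>n. y n /\<^sub>R norm (x n))"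
  have u: "u n \<in> unit_part" for n using direction_in_unit_part xy(1) x0 unfolding u_def by auto
  have vu: "v n - u n \<in> K" for n
    using scale_in[OF xy(2)[of n], of "inverse (norm (x n))"] by (simp add: u_def v_def scaleR_diff_right)
  have "norm (v n) \<le> inverse (real (Suc n))" for n
  proof -
    have "norm (v n) = norm (y n) / norm (x n)" by (simp add: v_def divide_inverse mult.commute)
    also have "\<dots> \<le> inverse (real (Suc n))"
      using xy(3)[of n] x0[of n] by (simp add: field_simps)
    finally show ?thesis .
  qed
  then have v0: "v \<longlonglongrightarrow> 0"
    by (intro Lim_null_comparison[OF _ LIMSEQ_inverse_real_of_nat]) auto
  obtain l r where lr: "l \<in> unit_part" "strict_mono r" "(u \<circ> r) \<longlonglongrightarrow> l"
    using compact_unit_part u unfolding compact_def by blast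
  have "(\<lambda>n. (v \<circ> r) n - (u \<circ> r) n) \<longlonglongrightarrow> 0 - l"
    using lr LIMSEQ_subseq_LIMSEQ[OF v0 lr(2)] by (intro tendsto_intros)
  then have "0 - l \<in> K"
    using closed_K vu unfolding closed_sequential_limits by (metis (no_types, lifting) comp_apply)
  with lr(1) pointed[of l] show False by auto
qed

section \<open>Generation of a cone by its extreme rays\<close>

text \<open>For \<open>x \<in> K\<close> this is the smallest face of \<open>K\<close> containing \<open>x\<close>.\<close>

definition min_face :: "'a \<Rightarrow> 'a set"
  where "min_face x = {y \<in> K. \<exists>t>0. x - t *\<^sub>R y \<in> K}"

lemma min_face_mono:
  assumes "s > 0" "x - s *\<^sub>R z \<in> K" shows "min_face z \<subseteq> min_face x"
proof
  fix y assume "y \<in> min_face z"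
  then obtain t where t: "y \<in> K" "t > 0" "z - t *\<^sub>R y \<in> K" unfolding min_face_def by auto
  have "x - (s * t) *\<^sub>R y \<in> K" using diff_scale_trans[OF t(3) assms(2)] assms(1) by simp
  then show "y \<in> min_face x"
    using t assms(1) unfolding min_face_def by (auto intro!: exI[of _ "s * t"])
qed

text \<open>Subtract from \<open>x\<close> the largest possible multiple of \<open>y\<close>, which exists by closedness and normality.
No positive multiple of \<open>y\<close> is below the rest, so \<open>y\<close> is not even in the linear span of its face.
This strict loss of dimension drives the induction in \<open>extreme_rays_generate\<close>.\<close>

lemma min_face_drops:
  assumes xK: "x \<in> K" and y: "y \<in> K" "y \<noteq> 0"
  obtains t where "t \<ge> 0" "x - t *\<^sub>R y \<in> K" "y \<notin> span (min_face (x - t *\<^sub>R y))"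
proof -
  obtain M where M: "M > 0" "\<And>x y. x \<in> K \<Longrightarrow> y - x \<in> K \<Longrightarrow> norm x \<le> M * norm y"
    using normality by blast
  define T where "T = {t. 0 \<le> t \<and> x - t *\<^sub>R y \<in> K}"
  have ne: "0 \<in> T" using xK by (simp add: T_def)
  have T_le: "t \<le> M * norm x / norm y" if "t \<in> T" for t
    using M(2)[of "t *\<^sub>R y" x] that scale_in[OF y(1), of t] y(2)
    by (simp add: T_def pos_le_divide_eq)
  have "closed T"
  proof -
    have "T = {0..} \<inter> (\<lambda>t. x - t *\<^sub>R y) -` K" unfolding T_def by auto
    then show ?thesis
      using closed_K by (auto intro!: closed_Int closed_vimage continuous_intros)
  qed
  moreover have "bdd_above T" using T_le by (meson bdd_aboveI)
  ultimately have SupT: "Sup T \<in> T" using ne closed_contains_Sup[of T] by auto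
  define z where "z = x - Sup T *\<^sub>R y"
  have zK: "z \<in> K" using SupT by (simp add: T_def z_def)
  have not: "z - s *\<^sub>R y \<notin> K" if "s > 0" for s
  proof
    assume "z - s *\<^sub>R y \<in> K"
    then have "Sup T + s \<in> T" using SupT that by (simp add: T_def z_def algebra_simps)
    then have "Sup T + s \<le> Sup T" using \<open>bdd_above T\<close> by (intro cSup_upper)
    with that show False by simp
  qed
  \<comment> \<open>A subspace, in contrast to the one-sided set of vectors with a multiple below \<open>z\<close>.\<close>
  have span_face: "span (min_face z) \<subseteq> {u. \<exists>s>0. z - s *\<^sub>R u \<in> K \<and> z + s *\<^sub>R u \<in> K}"
  proof (rule span_minimal)
    show "min_face z \<subseteq> {u. \<exists>s>0. z - s *\<^sub>R u \<in> K \<and> z + s *\<^sub>R u \<in> K}"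
      unfolding min_face_def using add_in[OF zK] scale_in by fastforce
    show "subspace {u. \<exists>s>0. z - s *\<^sub>R u \<in> K \<and> z + s *\<^sub>R u \<in> K}"
    proof (rule subspaceI)
      show "0 \<in> {u. \<exists>s>0. z - s *\<^sub>R u \<in> K \<and> z + s *\<^sub>R u \<in> K}"
        using zK by (auto intro: exI[of _ 1])
    next
      fix u v assume "u \<in> {u. \<exists>s>0. z - s *\<^sub>R u \<in> K \<and> z + s *\<^sub>R u \<in> K}"
        "v \<in> {u. \<exists>s>0. z - s *\<^sub>R u \<in> K \<and> z + s *\<^sub>R u \<in> K}"
      then obtain a b where ab: "a > 0" "z - a *\<^sub>R u \<in> K" "z + a *\<^sub>R u \<in> K"
        "b > 0" "z - b *\<^sub>R v \<in> K" "z + b *\<^sub>R v \<in> K" by blast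
      define s where "s = a * b / (a + b)"
      have coeffs: "b / (a + b) + a / (a + b) = 1" "b / (a + b) * a = s" "a / (a + b) * b = s"
        using ab(1,4) by (auto simp: s_def simp flip: add_divide_distrib)
      have split: "(b / (a + b)) *\<^sub>R z + (a / (a + b)) *\<^sub>R z = z"
        using coeffs(1) by (metis scaleR_add_left scaleR_one)
      have "(b / (a + b)) *\<^sub>R (z - a *\<^sub>R u) + (a / (a + b)) *\<^sub>R (z - b *\<^sub>R v) = z - s *\<^sub>R (u + v)"
        using split coeffs(2,3) by (simp add: scaleR_diff_right scaleR_add_right algebra_simps)
      moreover have "(b / (a + b)) *\<^sub>R (z + a *\<^sub>R u) + (a / (a + b)) *\<^sub>R (z + b *\<^sub>R v) = z + s *\<^sub>R (u + v)"
        using split coeffs(2,3) by (simp add: scaleR_add_right algebra_simps)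
      moreover have "b / (a + b) \<ge> 0" "a / (a + b) \<ge> 0" "s > 0" using ab(1,4) by (auto simp: s_def)
      ultimately show "u + v \<in> {u. \<exists>s>0. z - s *\<^sub>R u \<in> K \<and> z + s *\<^sub>R u \<in> K}"
        using ab by (metis (mono_tags, lifting) add_in mem_Collect_eq scale_in)
    next
      fix c u assume "u \<in> {u. \<exists>s>0. z - s *\<^sub>R u \<in> K \<and> z + s *\<^sub>R u \<in> K}"
      then obtain a where a: "a > 0" "z - a *\<^sub>R u \<in> K" "z + a *\<^sub>R u \<in> K" by blast
      show "c *\<^sub>R u \<in> {u. \<exists>s>0. z - s *\<^sub>R u \<in> K \<and> z + s *\<^sub>R u \<in> K}"
      proof (cases c "0::real" rule: linorder_cases)
        case equal then show ?thesis using zK by (auto intro: exI[of _ 1])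
      next
        case less
        with a show ?thesis by (auto intro!: exI[of _ "- a / c"] simp: divide_pos_neg)
      next
        case greater
        with a show ?thesis by (auto intro!: exI[of _ "a / c"])
      qed
    qed
  qed
  then have "y \<notin> span (min_face z)" using not by blast
  with SupT show ?thesis using that by (auto simp: T_def z_def)
qed

text \<open>Two points of \<open>K\<close> with a convex combination on the ray are, up to positive factors, below a
multiple of \<open>x\<close>, so they belong to the minimal face of \<open>x\<close> and hence to the line through \<open>x\<close>;
pointedness excludes its negative half.\<close>

lemma extreme_rayI:
  assumes x: "x \<in> K" "x \<noteq> 0" and face: "\<And>y. y \<in> min_face x \<Longrightarrow> \<exists>s. y = s *\<^sub>R x"
  shows "extreme_ray K {c *\<^sub>R x | c. 0 \<le> c}"
  unfolding extreme_ray_def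
proof (intro conjI exI[of _ x])
  let ?R = "{c *\<^sub>R x | c. 0 \<le> c}"
  have on_ray: "y \<in> ?R" if y: "y \<in> K" and t: "t > 0" "c *\<^sub>R x - t *\<^sub>R y \<in> K" "c > 0" for y t c
  proof -
    have "x - (t / c) *\<^sub>R y \<in> K"
      using scale_in[OF t(2), of "inverse c"] t(3) by (simp add: scaleR_diff_right divide_inverse_commute)
    then have "y \<in> min_face x" using y t(1,3) unfolding min_face_def by (auto intro!: exI[of _ "t / c"])
    then obtain s where s: "y = s *\<^sub>R x" using face by blast
    have "s \<ge> 0"
    proof (rule ccontr)
      assume "\<not> s \<ge> 0"
      then have "- x \<in> K" using scale_in[OF y, of "- inverse s"] s by simp
      with pointed x show False by blast
    qed
    with s show ?thesis by blast
  qed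
  show "?R face_of K"
    unfolding face_of_def
  proof (intro conjI ballI impI)
    show "?R \<subseteq> K" using x(1) scale_in by auto
    show "convex ?R"
    proof -
      have "?R = (\<lambda>c. c *\<^sub>R x) ` {0..}" by auto
      then show ?thesis by (auto intro!: convex_linear_image simp: linear_iff scaleR_add_left)
    qed
    fix a b w assume ab: "a \<in> K" "b \<in> K" and w: "w \<in> ?R" "w \<in> open_segment a b"
    then obtain c u where cu: "w = c *\<^sub>R x" "0 \<le> c" "a \<noteq> b" "0 < u" "u < 1" "w = (1 - u) *\<^sub>R a + u *\<^sub>R b"
      unfolding in_segment by force
    have "c \<noteq> 0"
    proof
      assume "c = 0"
      then have "(1 - u) *\<^sub>R a = - (u *\<^sub>R b)" "u *\<^sub>R b = - ((1 - u) *\<^sub>R a)"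
        using cu(1,6) by (simp_all add: eq_neg_iff_add_eq_0 add.commute)
      then have "(1 - u) *\<^sub>R a = 0" "u *\<^sub>R b = 0"
        using pointed[of "(1 - u) *\<^sub>R a"] pointed[of "u *\<^sub>R b"] scale_in[OF ab(1), of "1 - u"]
          scale_in[OF ab(2), of u] cu(4,5) by (metis diff_ge_0_iff_ge less_eq_real_def minus_minus)+
      with cu(3,4,5) show False by auto
    qed
    with cu have "c > 0" by simp
    moreover have "c *\<^sub>R x - (1 - u) *\<^sub>R a = u *\<^sub>R b" "c *\<^sub>R x - u *\<^sub>R b = (1 - u) *\<^sub>R a"
      using cu(1,6) by (simp_all add: algebra_simps)
    ultimately show "a \<in> ?R" "b \<in> ?R"
      using on_ray[of a "1 - u" c] on_ray[of b u c] ab cu(4,5) scale_in[of a "1 - u"] scale_in[of b u]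
      by auto
  qed
qed (use x in auto)

text \<open>The conic form of Minkowski's theorem, by induction on the dimension of the face of \<open>x\<close>. If \<open>x\<close>
does not span an extreme ray, its face contains a vector \<open>y\<close> off the ray. Moving from \<open>y\<close> away from
\<open>x\<close>, and then from \<open>x\<close> away from the point \<open>y'\<close> so reached, until the boundary of the cone is
met writes \<open>x\<close> as a combination of two vectors with smaller faces.\<close>

theorem extreme_rays_generate: "K = convex_cone hull (\<Union>{R. extreme_ray K R})"
proof -
  obtain S :: "'a set" where S: "finite S" "span S = UNIV" using fin_dim by blast
  obtain Basis :: "'a set" where B: "Basis \<subseteq> S" "independent Basis" "S \<subseteq> span Basis"
    using maximal_independent_subset by blast
  have "span Basis = UNIV" using B(3) S(2) by (metis span_mono span_span top.extremum_unique)
  then interpret fd: finite_dimensional_vector_space "(*\<^sub>R)" Basis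
    using B(1,2) finite_subset[OF B(1) S(1)]
    by unfold_locales (auto simp: dependent_raw_def span_raw_def)
  let ?H = "convex_cone hull (\<Union>{R. extreme_ray K R})"
  have "x \<in> ?H" if "x \<in> K" for x
    using that
  proof (induction "dim (min_face x)" arbitrary: x rule: less_induct)
    case less
    have dim_less: "dim (min_face z) < dim (min_face x)"
      if "s > 0" "x - s *\<^sub>R z \<in> K" "u \<in> min_face x" "u \<notin> span (min_face z)" for s z u
    proof -
      have "span (min_face z) \<subset> span (min_face x)"
        using that span_mono[OF min_face_mono[OF that(1,2)]] span_base by blast
      then show ?thesis using fd.dim_psubset by (simp add: dim_raw_def span_raw_def)
    qed
    show ?case
    proof (cases "\<exists>y \<in> min_face x. \<forall>s. y \<noteq> s *\<^sub>R x")
      case False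
      show ?thesis
      proof (cases "x = 0")
        case True then show ?thesis by (simp add: convex_cone_hull_contains_0)
      next
        case nz: False
        have "extreme_ray K {c *\<^sub>R x | c. 0 \<le> c}" using False less.prems nz by (intro extreme_rayI) auto
        moreover have "x \<in> {c *\<^sub>R x | c. 0 \<le> c}" by (auto intro!: exI[of _ 1])
        ultimately show ?thesis by (intro hull_inc) blast
      qed
    next
      case True
      then obtain y where y: "y \<in> min_face x" "\<And>s. y \<noteq> s *\<^sub>R x" by blast
      then have yK: "y \<in> K" unfolding min_face_def by auto
      obtain t0 where t0: "t0 > 0" "x - t0 *\<^sub>R y \<in> K" using y(1) unfolding min_face_def by auto
      have x_face: "x \<in> min_face x" using less.prems zero_in by (auto simp: min_face_def intro!: exI[of _ 1])
      have xnz: "x \<noteq> 0"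
        using t0 yK y(2)[of 0] pointed[of "t0 *\<^sub>R y"] scale_in[OF yK, of t0] by auto
      obtain t where t: "t \<ge> 0" "y - t *\<^sub>R x \<in> K" "x \<notin> span (min_face (y - t *\<^sub>R x))"
        using min_face_drops[OF yK less.prems xnz] by blast
      define y' where "y' = y - t *\<^sub>R x"
      have y'nz: "y' \<noteq> 0" using y(2)[of t] by (simp add: y'_def)
      have x_y': "x - t0 *\<^sub>R y' \<in> K"
        using add_in[OF t0(2) scale_in[OF less.prems, of "t0 * t"]] t0(1) t(1)
        by (simp add: y'_def algebra_simps)
      have "y' \<in> ?H"
        using less.hyps dim_less[OF t0(1) x_y' x_face] t unfolding y'_def by blast
      moreover obtain s where s: "s \<ge> 0" "x - s *\<^sub>R y' \<in> K" "y' \<notin> span (min_face (x - s *\<^sub>R y'))"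
        using min_face_drops[OF less.prems _ y'nz] t(2) y'_def by blast
      have "x - s *\<^sub>R y' \<in> ?H"
      proof (rule less.hyps)
        have "y' \<in> min_face x" using x_y' t0(1) t(2) by (auto simp: min_face_def y'_def)
        moreover have "x - 1 *\<^sub>R (x - s *\<^sub>R y') \<in> K" using scale_in s(1) t(2) y'_def by auto
        ultimately show "dim (min_face (x - s *\<^sub>R y')) < dim (min_face x)"
          using dim_less[of 1 "x - s *\<^sub>R y'" y'] s(3) by auto
      qed (fact s(2))
      ultimately have "(x - s *\<^sub>R y') + s *\<^sub>R y' \<in> ?H"
        using s(1) by (intro convex_cone_hull_add convex_cone_hull_mul)
      then show ?thesis by simp
    qed
  qed
  moreover have "?H \<subseteq> K"
  proof (rule hull_minimal)
    show "\<Union>{R. extreme_ray K R} \<subseteq> K" by (auto simp: extreme_ray_def face_of_def)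
    show "convex_cone K" using add_in scale_in zero_in by (auto simp: convex_cone_iff)
  qed
  ultimately show ?thesis by blast
qed

end

section \<open>Lower semicontinuity of the order of a polyhedral cone\<close>

lemma convex_cone_hull_insertE:
  assumes "y \<in> convex_cone hull (insert v S)"
  obtains a z where "0 \<le> a" "z \<in> convex_cone hull S" "y = a *\<^sub>R v + z"
proof -
  have "convex_cone hull {v} \<subseteq> {a *\<^sub>R v | a. 0 \<le> a}"
  proof (rule hull_minimal)
    show "{v} \<subseteq> {a *\<^sub>R v | a. 0 \<le> a}" by (auto intro!: exI[of _ 1])
    show "convex_cone {a *\<^sub>R v | a. 0 \<le> a}"
      unfolding convex_cone_iff by (auto simp flip: scaleR_add_left)
  qed
  moreover have "y \<in> convex_cone hull ({v} \<union> S)" using assms by simp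
  ultimately show ?thesis using that unfolding convex_cone_hull_Un by blast
qed

locale closed_polyhedral_cone = closed_cone +
  assumes finite_rays: "finite {R. extreme_ray K R}"
begin

lemma finitely_generated: "\<exists>V. finite V \<and> K = convex_cone hull V"
proof -
  have "\<exists>x. R = {c *\<^sub>R x | c. 0 \<le> c}" if "extreme_ray K R" for R
    using that unfolding extreme_ray_def by blast
  then have "\<forall>R. \<exists>x. extreme_ray K R \<longrightarrow> R = {c *\<^sub>R x | c. 0 \<le> c}" by blast
  from choice[OF this] obtain gen where
    gen: "\<And>R. extreme_ray K R \<Longrightarrow> R = {c *\<^sub>R gen R | c. 0 \<le> c}" by blast
  define V where "V = gen ` {R. extreme_ray K R}"
  have "V \<subseteq> \<Union>{R. extreme_ray K R}"
  proof
    fix v assume "v \<in> V"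
    then obtain R where R: "extreme_ray K R" "v = gen R" unfolding V_def by auto
    then have "v \<in> R" using gen[OF R(1)] by (auto intro!: exI[of _ 1])
    with R show "v \<in> \<Union>{R. extreme_ray K R}" by blast
  qed
  moreover have "\<Union>{R. extreme_ray K R} \<subseteq> convex_cone hull V"
  proof
    fix x assume "x \<in> \<Union>{R. extreme_ray K R}"
    then obtain R where R: "extreme_ray K R" "x \<in> R" by auto
    then obtain c where "x = c *\<^sub>R gen R" "0 \<le> c" using gen[OF R(1)] by auto
    moreover have "gen R \<in> convex_cone hull V" using R by (intro hull_inc) (auto simp: V_def)
    ultimately show "x \<in> convex_cone hull V" by (simp add: convex_cone_hull_mul)
  qed
  ultimately have "convex_cone hull V = convex_cone hull (\<Union>{R. extreme_ray K R})"
    by (meson hull_minimal hull_mono convex_cone_convex_cone_hull subset_antisym)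
  then show ?thesis using extreme_rays_generate finite_rays by (auto simp: V_def)
qed

text \<open>Write the sequence in the generators. Normality bounds each coefficient, so a subsequence of the
coefficients converges, and the comparison with \<open>c *\<^sub>R x\<close> can be made coefficient by coefficient.\<close>

lemma lower_semicontinuous_on_generators:
  assumes "finite S" "S \<subseteq> K" "\<And>n. Y n \<in> convex_cone hull S" "Y \<longlonglongrightarrow> x"
  shows "\<exists>r. strict_mono r \<and> (\<forall>c<1. \<forall>\<^sub>F n in sequentially. Y (r n) - c *\<^sub>R x \<in> K)"
  using assms
proof (induction S arbitrary: Y x rule: finite_induct)
  case empty
  then have "Y = (\<lambda>n. 0)" by auto
  with empty(3) have "x = 0" by (simp add: LIMSEQ_const_iff)
  then show ?case using \<open>Y = _\<close> zero_in by (intro exI[of _ id]) (auto simp: strict_mono_def)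
next
  case (insert v S)
  have hull_K: "convex_cone hull S \<subseteq> K"
    using insert.prems(1) add_in scale_in zero_in by (intro hull_minimal) (auto simp: convex_cone_iff)
  have vK: "v \<in> K" using insert.prems by auto
  have "\<exists>a z. 0 \<le> a \<and> z \<in> convex_cone hull S \<and> Y n = a *\<^sub>R v + z" for n
    using convex_cone_hull_insertE[OF insert.prems(2)[of n]] by metis
  then obtain a z where az: "\<And>n. 0 \<le> a n" "\<And>n. z n \<in> convex_cone hull S" "\<And>n. Y n = a n *\<^sub>R v + z n"
    by metis
  show ?case
  proof (cases "v = 0")
    case True
    then have "\<And>n. Y n \<in> convex_cone hull S" using az by simp
    with insert show ?thesis by simp
  next
    case False
    obtain M where M: "M > 0" "\<And>x y. x \<in> K \<Longrightarrow> y - x \<in> K \<Longrightarrow> norm x \<le> M * norm y"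
      using normality by blast
    obtain C where C: "\<And>n. norm (Y n) \<le> C"
      using convergent_imp_bounded[OF insert.prems(3)] unfolding bounded_iff by auto
    have "\<bar>a n\<bar> \<le> M * C / norm v" for n
    proof -
      have "norm (a n *\<^sub>R v) \<le> M * norm (Y n)"
        using az hull_K scale_in[OF vK] by (intro M(2)) auto
      also have "\<dots> \<le> M * C" using C M(1) by simp
      finally show ?thesis using False by (simp add: pos_le_divide_eq)
    qed
    then have "bounded (range a)" unfolding bounded_iff by auto
    then obtain b r1 where r1: "strict_mono r1" "(a \<circ> r1) \<longlonglongrightarrow> b"
      using bounded_imp_convergent_subsequence by blast
    have b0: "b \<ge> 0" using r1(2) az(1) by (intro LIMSEQ_le_const) auto
    have "(\<lambda>n. (Y \<circ> r1) n - (a \<circ> r1) n *\<^sub>R v) \<longlonglongrightarrow> x - b *\<^sub>R v"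
      using LIMSEQ_subseq_LIMSEQ[OF insert.prems(3) r1(1)] r1(2) by (intro tendsto_intros)
    moreover have "(\<lambda>n. (Y \<circ> r1) n - (a \<circ> r1) n *\<^sub>R v) = z \<circ> r1" using az(3) by auto
    ultimately obtain r2 where r2: "strict_mono r2"
      "\<And>c. c < 1 \<Longrightarrow> \<forall>\<^sub>F n in sequentially. (z \<circ> r1) (r2 n) - c *\<^sub>R (x - b *\<^sub>R v) \<in> K"
      using insert.IH[of "z \<circ> r1" "x - b *\<^sub>R v"] insert.prems(1) az(2) by fastforce
    have a_lim: "(\<lambda>n. a (r1 (r2 n))) \<longlonglongrightarrow> b"
      using LIMSEQ_subseq_LIMSEQ[OF r1(2) r2(1)] by (simp add: o_def)
    have "\<forall>\<^sub>F n in sequentially. Y ((r1 \<circ> r2) n) - c *\<^sub>R x \<in> K" if c: "c < 1" for c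
    proof -
      \<comment> \<open>Either the limit coefficient is \<open>0\<close> and there is nothing to lose, or it is positive and
        the coefficients eventually exceed any smaller multiple of it.\<close>
      have "\<forall>\<^sub>F n in sequentially. c * b \<le> a (r1 (r2 n))"
      proof (cases "b = 0")
        case True then show ?thesis using az(1) by simp
      next
        case False
        with b0 c have "c * b < b" by simp
        from order_tendstoD(1)[OF a_lim this] show ?thesis by eventually_elim simp
      qed
      with r2(2)[OF c] show ?thesis
      proof eventually_elim
        case (elim n)
        have "(z (r1 (r2 n)) - c *\<^sub>R (x - b *\<^sub>R v)) + (a (r1 (r2 n)) - c * b) *\<^sub>R v \<in> K"
          using elim scale_in[OF vK] by (intro add_in) auto
        then show ?case by (simp add: az(3) algebra_simps)
      qed
    qed
    then show ?thesis using r1 r2 by (intro exI[of _ "r1 \<circ> r2"]) (auto simp: strict_mono_def)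
  qed
qed

text \<open>This is the one property of polyhedral cones that the continuity theorem rests on; it fails, for
example, for boundary points of a circular cone. For a cone given by finitely many inequalities
\<open>\<phi> \<ge> 0\<close> it is clear: if \<open>\<phi> x > 0\<close>, then \<open>\<phi> y \<ge> c * \<phi> x\<close> for \<open>y\<close> near \<open>x\<close>, and if \<open>\<phi> x = 0\<close>, then
the same holds for every \<open>y \<in> K\<close>. Here it is obtained from generators instead.\<close>

theorem order_lower_semicontinuous:
  assumes x: "x \<in> K" and c: "c < 1"
  shows "\<exists>d>0. \<forall>y\<in>K. dist x y < d \<longrightarrow> y - c *\<^sub>R x \<in> K"
proof (rule ccontr)
  assume "\<not> ?thesis"
  then have "\<forall>n. \<exists>y\<in>K. dist x y < inverse (real (Suc n)) \<and> y - c *\<^sub>R x \<notin> K"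
    by (metis inverse_positive_iff_positive of_nat_0_less_iff zero_less_Suc)
  then obtain Y where Y: "\<And>n. Y n \<in> K" "\<And>n. dist x (Y n) < inverse (real (Suc n))"
    "\<And>n. Y n - c *\<^sub>R x \<notin> K" by metis
  obtain V where V: "finite V" "K = convex_cone hull V" using finitely_generated by blast
  have "(\<lambda>n. dist (Y n) x) \<longlonglongrightarrow> 0"
  proof (rule Lim_null_comparison[OF _ LIMSEQ_inverse_real_of_nat])
    show "\<forall>\<^sub>F n in sequentially. norm (dist (Y n) x) \<le> inverse (real (Suc n))"
      using Y(2) by (auto simp: dist_commute simp del: of_nat_Suc intro!: always_eventually less_imp_le)
  qed
  then have "Y \<longlonglongrightarrow> x" by (rule tendsto_dist_iff[THEN iffD2])
  moreover have "V \<subseteq> K" using V(2) hull_subset by metis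
  ultimately obtain r where "\<forall>\<^sub>F n in sequentially. Y (r n) - c *\<^sub>R x \<in> K"
    using lower_semicontinuous_on_generators[OF V(1), of Y x] Y(1) V(2) c by auto
  with Y(3) show False by simp
qed

end



section \<open>Cone maps and their compositions\<close>

text \<open>A composition of members of a family is indexed by a sequence of maps, the first one applied first,
rather than by a list. This way limits of sequences of compositions can be taken factor by factor,
and the intermediate points stay accessible.\<close>

primrec trajectory :: "(nat \<Rightarrow> 'a \<Rightarrow> 'a) \<Rightarrow> nat \<Rightarrow> 'a \<Rightarrow> 'a" where
  "trajectory F 0 = id"
| "trajectory F (Suc n) = F n \<circ> trajectory F n"

lemma trajectory_cong: "(\<And>i. i < n \<Longrightarrow> F i = G i) \<Longrightarrow> trajectory F n = trajectory G n"
  by (induction n) auto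

lemma trajectory_add: "trajectory F (m + n) = trajectory (\<lambda>i. F (m + i)) n \<circ> trajectory F m"
  by (induction n) auto

lemma family_power_0: "family_power A 0 = {id}"
  by (auto simp: family_power_def)

lemma family_power_Suc: "family_power A (Suc n) = {f \<circ> g | f g. f \<in> A \<and> g \<in> family_power A n}"
proof (intro subset_antisym subsetI)
  fix h assume "h \<in> family_power A (Suc n)"
  then obtain fs where "h = foldr (\<circ>) fs id" "length fs = Suc n" "set fs \<subseteq> A"
    by (auto simp: family_power_def)
  then show "h \<in> {f \<circ> g | f g. f \<in> A \<and> g \<in> family_power A n}"
    unfolding family_power_def by (cases fs) fastforce+
next
  fix h assume "h \<in> {f \<circ> g | f g. f \<in> A \<and> g \<in> family_power A n}"
  then obtain f fs where "f \<in> A" "h = f \<circ> foldr (\<circ>) fs id" "length fs = n" "set fs \<subseteq> A"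
    by (auto simp: family_power_def)
  then show "h \<in> family_power A (Suc n)"
    unfolding family_power_def by (intro CollectI exI[of _ "f # fs"]) auto
qed

lemma trajectory_in_family_power: "(\<And>i. i < n \<Longrightarrow> F i \<in> A) \<Longrightarrow> trajectory F n \<in> family_power A n"
  by (induction n) (auto simp: family_power_0 family_power_Suc)

lemma family_power_trajectoryE:
  assumes "A \<noteq> {}" "g \<in> family_power A n"
  obtains F where "\<And>i. F i \<in> A" "g = trajectory F n"
proof -
  have "\<exists>F. (\<forall>i. F i \<in> A) \<and> g = trajectory F n"
    using assms(2)
  proof (induction n arbitrary: g)
    case 0
    with assms(1) show ?case by (auto simp: family_power_0)
  next
    case (Suc n)
    then obtain f h where fh: "g = f \<circ> h" "f \<in> A" "h \<in> family_power A n"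
      by (auto simp: family_power_Suc)
    with Suc.IH obtain F where F: "\<And>i. F i \<in> A" "h = trajectory F n" by blast
    have "trajectory (F(n := f)) n = trajectory F n" by (rule trajectory_cong) auto
    then have "g = trajectory (F(n := f)) (Suc n)"
      by (simp only: trajectory.simps fun_upd_same fh(1) F(2))
    with fh(2) F(1) show ?case by (metis fun_upd_apply)
  qed
  with that show ?thesis by blast
qed

lemma family_power_comp:
  assumes "g \<in> family_power A m" "h \<in> family_power A n"
  shows "g \<circ> h \<in> family_power A (m + n)"
  using assms(1)
proof (induction m arbitrary: g)
  case 0
  with assms(2) show ?case by (simp add: family_power_0)
next
  case (Suc m)
  then obtain f g' where "g = f \<circ> g'" "f \<in> A" "g' \<in> family_power A m"
    by (auto simp: family_power_Suc)
  moreover from this have "g \<circ> h = f \<circ> (g' \<circ> h)" by (simp add: o_assoc)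
  ultimately show ?case using Suc.IH[of g'] by (auto simp only: family_power_Suc add_Suc)
qed

lemma family_power_funpow:
  "g \<in> family_power A m \<Longrightarrow> g ^^ k \<in> family_power A (m * k)"
  by (induction k) (auto simp: family_power_0 family_power_comp)

context closed_cone
begin

lemma cone_map_in: "f \<in> cone_maps K \<Longrightarrow> x \<in> K \<Longrightarrow> f x \<in> K"
  by (auto simp: cone_maps_def)

lemma cone_map_mono: "f \<in> cone_maps K \<Longrightarrow> x \<in> K \<Longrightarrow> y \<in> K \<Longrightarrow> y - x \<in> K \<Longrightarrow> f y - f x \<in> K"
  by (auto simp: cone_maps_def order_preserving_on_def cone_le_def)

lemma cone_map_zero:
  assumes "f \<in> cone_maps K" shows "f 0 = 0"
proof -
  have "f (2 *\<^sub>R 0) = 2 *\<^sub>R f 0"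
    using assms zero_in unfolding cone_maps_def homogeneous_on_def by force
  then have "f 0 = f 0 + f 0" by (simp add: scaleR_2)
  then show ?thesis by simp
qed

lemma cone_map_scale: "f \<in> cone_maps K \<Longrightarrow> x \<in> K \<Longrightarrow> 0 \<le> c \<Longrightarrow> f (c *\<^sub>R x) = c *\<^sub>R f x"
  using cone_map_zero[of f] by (cases "c = 0") (auto simp: cone_maps_def homogeneous_on_def)

lemma id_cone_map: "id \<in> cone_maps K"
  by (auto simp: cone_maps_def order_preserving_on_def homogeneous_on_def)

lemma comp_cone_map:
  assumes "f \<in> cone_maps K" "g \<in> cone_maps K" shows "f \<circ> g \<in> cone_maps K"
proof -
  have "continuous_on K (f \<circ> g)"
  proof (rule continuous_on_compose)
    show "continuous_on K g" using assms(2) by (simp add: cone_maps_def)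
    have "continuous_on K f" "g ` K \<subseteq> K" using assms by (auto simp: cone_maps_def)
    then show "continuous_on (g ` K) f" by (rule continuous_on_subset)
  qed
  with assms show ?thesis
    unfolding cone_maps_def order_preserving_on_def homogeneous_on_def Pi_iff mem_Collect_eq
    by (simp add: o_def)
qed

lemma funpow_cone_map: "f \<in> cone_maps K \<Longrightarrow> f ^^ n \<in> cone_maps K"
  by (induction n) (simp_all only: funpow.simps comp_cone_map id_cone_map)

lemma trajectory_cone_map: "(\<And>i. F i \<in> cone_maps K) \<Longrightarrow> trajectory F n \<in> cone_maps K"
  by (induction n) (auto intro: comp_cone_map id_cone_map)

lemma family_power_cone_maps: "A \<subseteq> cone_maps K \<Longrightarrow> family_power A n \<subseteq> cone_maps K"
  by (induction n) (auto simp: family_power_0 family_power_Suc intro: comp_cone_map id_cone_map)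

lemma cone_map_diff_le:
  assumes "f \<in> cone_maps K" "g \<in> cone_maps K" "\<And>x. x \<in> cone_ball K \<Longrightarrow> norm (f x - g x) \<le> e" "x \<in> K"
  shows "norm (f x - g x) \<le> e * norm x"
proof (cases "x = 0")
  case True
  then show ?thesis using cone_map_zero[OF assms(1)] cone_map_zero[OF assms(2)] by simp
next
  case False
  define u where "u = x /\<^sub>R norm x"
  have u: "u \<in> K" "norm u = 1" "x = norm x *\<^sub>R u"
    using direction_in_unit_part[OF assms(4) False] False unfolding u_def by auto
  have "f x - g x = norm x *\<^sub>R (f u - g u)"
    using cone_map_scale[OF assms(1) u(1)] cone_map_scale[OF assms(2) u(1)] u(3)
    by (metis norm_ge_zero scaleR_diff_right)
  then have "norm (f x - g x) = norm x * norm (f u - g u)" by simp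
  also have "\<dots> \<le> norm x * e"
    using assms(3)[of u] u by (intro mult_left_mono) (auto simp: cone_ball_def)
  finally show ?thesis by (simp add: mult.commute)
qed

lemma tendsto_cone_map:
  assumes f: "\<And>n. f n \<in> cone_maps K" "g \<in> cone_maps K"
    and close: "\<And>n x. x \<in> cone_ball K \<Longrightarrow> norm (f n x - g x) \<le> e n" "e \<longlonglongrightarrow> 0"
    and X: "\<And>n. X n \<in> K" "X \<longlonglongrightarrow> x"
  shows "(\<lambda>n. f n (X n)) \<longlonglongrightarrow> g x"
proof -
  have xK: "x \<in> K" using closed_K X unfolding closed_sequential_limits by blast
  have "(\<lambda>n. f n (X n) - g (X n)) \<longlonglongrightarrow> 0"
  proof (rule Lim_null_comparison)
    show "\<forall>\<^sub>F n in sequentially. norm (f n (X n) - g (X n)) \<le> e n * norm (X n)"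
      using cone_map_diff_le[OF f close(1)] X(1) by simp
    show "(\<lambda>n. e n * norm (X n)) \<longlonglongrightarrow> 0"
      using tendsto_mult[OF close(2) tendsto_norm[OF X(2)]] by simp
  qed
  moreover have "(\<lambda>n. g (X n)) \<longlonglongrightarrow> g x"
    using f(2) X xK by (intro continuous_on_tendsto_compose[of K g]) (auto simp: cone_maps_def)
  ultimately have "(\<lambda>n. (f n (X n) - g (X n)) + g (X n)) \<longlonglongrightarrow> 0 + g x" by (rule tendsto_add)
  then show ?thesis by simp
qed

end

section \<open>Compact families\<close>

text \<open>Compactness is stated sequentially. The rate \<open>e\<close> expresses uniform convergence on the
unit part of the cone; by homogeneity it controls the maps on all of \<open>K\<close>.\<close>

locale compact_cone_family = closed_cone K for K :: "'a::real_normed_vector set" +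
  fixes A :: "('a \<Rightarrow> 'a) set"
  assumes nonempty: "A \<noteq> {}" and cone_maps: "A \<subseteq> cone_maps K"
    and seq_compact: "\<And>F :: nat \<Rightarrow> 'a \<Rightarrow> 'a. (\<And>n. F n \<in> A) \<Longrightarrow>
      \<exists>f\<in>A. \<exists>r e. strict_mono r \<and> e \<longlonglongrightarrow> (0::real) \<and>
        (\<forall>n. \<forall>x\<in>cone_ball K. norm (F (r n) x - f x) \<le> e n)"
begin

text \<open>The compactness argument behind all limits below. The maps \<open>F j i\<close> need not belong to the family
but approach it as \<open>j\<close> grows, which covers families converging to \<open>A\<close> in the Hausdorff metric.
The subsequence is refined once for each of the \<open>m\<close> factors.\<close>

lemma trajectories_subseq:
  assumes F: "\<And>j i. F j i \<in> cone_maps K" and G: "\<And>j i. G j i \<in> A"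
    and close: "\<And>j i x. x \<in> cone_ball K \<Longrightarrow> norm (F j i x - G j i x) \<le> e j" "e \<longlonglongrightarrow> 0"
    and X: "\<And>j. X j \<in> K" "X \<longlonglongrightarrow> x"
  shows "\<exists>r H. strict_mono r \<and> (\<forall>i. H i \<in> A) \<and>
    (\<forall>i\<le>m. (\<lambda>j. trajectory (F (r j)) i (X (r j))) \<longlonglongrightarrow> trajectory H i x)"
proof (induction m)
  case 0
  obtain a where "a \<in> A" using nonempty by blast
  with X show ?case by (intro exI[of _ id] exI[of _ "\<lambda>_. a"]) (auto simp: strict_mono_def)
next
  case (Suc m)
  then obtain r H where r: "strict_mono r" and H: "\<And>i. H i \<in> A"
    and lim: "\<And>i. i \<le> m \<Longrightarrow> (\<lambda>j. trajectory (F (r j)) i (X (r j))) \<longlonglongrightarrow> trajectory H i x"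
    by blast
  obtain h r' e' where h: "h \<in> A" "strict_mono r'" "e' \<longlonglongrightarrow> 0"
    "\<And>n x. x \<in> cone_ball K \<Longrightarrow> norm (G (r (r' n)) m x - h x) \<le> e' n"
    using seq_compact[of "\<lambda>j. G (r j) m"] G by blast
  define R where "R = (\<lambda>j. r (r' j))"
  have R: "strict_mono R" using r h(2) by (auto simp: R_def strict_mono_def)
  define H' where "H' = H(m := h)"
  have H'_traj: "trajectory H' i = trajectory H i" if "i \<le> m" for i
    using that by (intro trajectory_cong) (auto simp: H'_def)
  have old: "(\<lambda>j. trajectory (F (R j)) i (X (R j))) \<longlonglongrightarrow> trajectory H' i x" if "i \<le> m" for i
    using LIMSEQ_subseq_LIMSEQ[OF lim[OF that] h(2)] by (simp add: o_def R_def H'_traj[OF that])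
  have "(\<lambda>j. F (R j) m (trajectory (F (R j)) m (X (R j)))) \<longlonglongrightarrow> h (trajectory H' m x)"
  proof (rule tendsto_cone_map[where f = "\<lambda>j. F (R j) m" and g = h])
    show "norm (F (R n) m y - h y) \<le> e (R n) + e' n" if "y \<in> cone_ball K" for n y
      using norm_triangle_mono[OF close(1)[OF that, of "R n" m] h(4)[OF that, of n]]
      by (simp add: R_def)
    show "(\<lambda>n. e (R n) + e' n) \<longlonglongrightarrow> 0"
      using tendsto_add[OF LIMSEQ_subseq_LIMSEQ[OF close(2) R] h(3)] by (simp add: o_def)
    show "trajectory (F (R n)) m (X (R n)) \<in> K" for n
      using trajectory_cone_map[of "F (R n)" m] F X(1) cone_map_in by blast
  qed (use F h(1) cone_maps old in auto)
  then have "(\<lambda>j. trajectory (F (R j)) i (X (R j))) \<longlonglongrightarrow> trajectory H' i x" if "i \<le> Suc m" for i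
    using old that by (cases "i = Suc m") (auto simp: H'_def o_def)
  moreover have "\<forall>i. H' i \<in> A" using H h(1) by (auto simp: H'_def)
  ultimately show ?case using R by blast
qed

corollary trajectories_subseq_in:
  assumes F: "\<And>j i. F j i \<in> A" and X: "\<And>j. X j \<in> K" "X \<longlonglongrightarrow> x"
  shows "\<exists>r H. strict_mono r \<and> (\<forall>i. H i \<in> A) \<and>
    (\<forall>i\<le>m. (\<lambda>j. trajectory (F (r j)) i (X (r j))) \<longlonglongrightarrow> trajectory H i x)"
proof -
  have "F j i \<in> cone_maps K" for j i using F cone_maps by blast
  from trajectories_subseq[of F F, OF this F, where e = "\<lambda>_. 0"] X show ?thesis by auto
qed

lemma family_bounded: "\<exists>L\<ge>1. \<forall>f\<in>A. \<forall>x\<in>K. norm (f x) \<le> L * norm x"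
proof (rule ccontr)
  assume neg: "\<not> ?thesis"
  have "\<exists>f u. f \<in> A \<and> u \<in> unit_part \<and> norm (f u) > real n" for n
  proof -
    obtain f x where fx: "f \<in> A" "x \<in> K" "norm (f x) > real (Suc n) * norm x"
    proof -
      have "real (Suc n) \<ge> 1" by simp
      with neg that show ?thesis by (meson not_le)
    qed
    then have "x \<noteq> 0" using cone_map_zero[of f] cone_maps by auto
    define u where "u = x /\<^sub>R norm x"
    have "f u = f x /\<^sub>R norm x" using fx cone_maps by (auto simp: u_def intro!: cone_map_scale)
    then have "norm (f u) = norm (f x) / norm x" by (simp add: divide_inverse mult.commute)
    moreover have "real n * norm x < norm (f x)"
      using fx(3) by (rule le_less_trans[rotated]) (simp add: mult_right_mono)
    ultimately have "norm (f u) > real n" using \<open>x \<noteq> 0\<close> by (simp add: pos_less_divide_eq)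
    then show ?thesis using direction_in_unit_part[OF fx(2) \<open>x \<noteq> 0\<close>] fx(1) u_def by blast
  qed
  then obtain f u where fu: "\<And>n. f n \<in> A" "\<And>n. u n \<in> unit_part" "\<And>n. norm (f n (u n)) > real n"
    by metis
  obtain l r where r: "strict_mono r" "(u \<circ> r) \<longlonglongrightarrow> l"
    using compact_unit_part fu(2) unfolding compact_def by metis
  obtain r' H where r': "strict_mono r'"
    "\<And>i. i \<le> 1 \<Longrightarrow> (\<lambda>j. trajectory (\<lambda>i. f (r (r' j))) i ((u \<circ> r) (r' j))) \<longlonglongrightarrow> trajectory H i l"
    using trajectories_subseq_in[of "\<lambda>j i. f (r j)" "u \<circ> r" l 1] r(2) fu by auto
  have "(\<lambda>j. f (r (r' j)) (u (r (r' j)))) \<longlonglongrightarrow> H 0 l"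
    using r'(2)[of 1] by simp
  then have "bounded (range (\<lambda>j. f (r (r' j)) (u (r (r' j)))))" by (rule convergent_imp_bounded)
  then obtain b where b: "\<And>j. norm (f (r (r' j)) (u (r (r' j)))) \<le> b" unfolding bounded_iff by auto
  obtain j where "b < real j" using reals_Archimedean2 by blast
  moreover have "j \<le> r (r' j)" using seq_suble[OF r(1)] seq_suble[OF r'(1)] by (meson le_trans)
  ultimately show False using b[of j] fu(3)[of "r (r' j)"] by linarith
qed

lemma norm_trajectory_le:
  assumes L: "L \<ge> 0" "\<And>f x. f \<in> A \<Longrightarrow> x \<in> K \<Longrightarrow> norm (f x) \<le> L * norm x"
    and F: "\<And>i. F i \<in> A" and x: "x \<in> K"
  shows "norm (trajectory F n x) \<le> L ^ n * norm x"
proof (induction n)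
  case (Suc n)
  have "norm (trajectory F (Suc n) x) \<le> L * norm (trajectory F n x)"
    using L(2)[OF F] trajectory_cone_map[of F n] F cone_maps x cone_map_in by fastforce
  also have "\<dots> \<le> L * (L ^ n * norm x)" using Suc L(1) by (rule mult_left_mono)
  finally show ?case by (simp add: mult.assoc)
qed simp

end



section \<open>Maps that nearly realize the growth of the family\<close>

context compact_cone_family
begin

definition growth_bounded_by :: "real \<Rightarrow> bool"
  where "growth_bounded_by m \<longleftrightarrow>
    (\<exists>C. \<forall>n. \<forall>g\<in>family_power A n. \<forall>x\<in>K. norm (g x) \<le> C * m ^ n * norm x)"

text \<open>The rate is required at all intermediate times and not only at the end. A vector that is not
persistent then has on each of its trajectories a definite time, at most \<open>N\<close>, at which the norm is
behind and the trajectory can be restarted.\<close>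

definition persistent :: "real \<Rightarrow> nat \<Rightarrow> 'a set"
  where "persistent m N =
    {x \<in> unit_part. \<exists>F. (\<forall>i. F i \<in> A) \<and> (\<forall>j\<le>N. m ^ j \<le> norm (trajectory F j x))}"

definition persistent_core :: "real \<Rightarrow> 'a set"
  where "persistent_core m = (\<Inter>N. persistent m N)"

lemma trajectory_in: "(\<And>i. F i \<in> A) \<Longrightarrow> x \<in> K \<Longrightarrow> trajectory F n x \<in> K"
  using trajectory_cone_map[of F n] cone_maps cone_map_in by blast

text \<open>The rate \<open>m\<close> and the horizon \<open>k\<close> may vary along the sequence. This gives compactness of the core
when the rate is constant, and uniformity on compact sets that avoid the core when it increases to \<open>l\<close>.\<close>

lemma persistent_limit:
  assumes X: "\<And>n. X n \<in> persistent (m n) (k n)" "\<And>n. n \<le> k n" "X \<longlonglongrightarrow> x"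
    and m: "m \<longlonglongrightarrow> l"
  shows "x \<in> persistent_core l"
proof -
  have XU: "\<And>n. X n \<in> unit_part" using X(1) by (auto simp: persistent_def)
  have xU: "x \<in> unit_part"
    using compact_unit_part[THEN compact_imp_closed] XU X(3) unfolding closed_sequential_limits by blast
  have "\<forall>n. \<exists>F. (\<forall>i. F i \<in> A) \<and> (\<forall>j\<le>k n. m n ^ j \<le> norm (trajectory F j (X n)))"
    using X(1) by (auto simp: persistent_def)
  then obtain F where F: "\<And>n i. F n i \<in> A"
    "\<And>n j. j \<le> k n \<Longrightarrow> m n ^ j \<le> norm (trajectory (F n) j (X n))" by metis
  have "x \<in> persistent l N" for N
  proof -
    obtain r H where r: "strict_mono r" "\<And>i. H i \<in> A"
      and lim: "\<And>i. i \<le> N \<Longrightarrow> (\<lambda>j. trajectory (F (r j)) i (X (r j))) \<longlonglongrightarrow> trajectory H i x"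
      using trajectories_subseq_in[of F X x N] F(1) XU X(3) by auto
    have "l ^ j \<le> norm (trajectory H j x)" if "j \<le> N" for j
    proof (rule LIMSEQ_le)
      show "(\<lambda>n. m (r n) ^ j) \<longlonglongrightarrow> l ^ j"
        using LIMSEQ_subseq_LIMSEQ[OF m r(1)] by (auto simp: o_def intro: tendsto_power)
      show "(\<lambda>n. norm (trajectory (F (r n)) j (X (r n)))) \<longlonglongrightarrow> norm (trajectory H j x)"
        using lim[OF that] by (rule tendsto_norm)
      show "\<exists>M. \<forall>n\<ge>M. m (r n) ^ j \<le> norm (trajectory (F (r n)) j (X (r n)))"
      proof (intro exI[of _ N] allI impI F(2))
        fix n assume "N \<le> n"
        with that seq_suble[OF r(1), of n] X(2)[of "r n"] show "j \<le> k (r n)" by linarith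
      qed
    qed
    then show ?thesis using xU r(2) by (auto simp: persistent_def)
  qed
  then show ?thesis by (simp add: persistent_core_def)
qed

lemma compact_persistent_core: "compact (persistent_core l)"
  unfolding compact_def
proof (intro allI impI)
  fix X :: "nat \<Rightarrow> 'a" assume X: "\<forall>n. X n \<in> persistent_core l"
  then have "\<forall>n. X n \<in> unit_part" by (auto simp: persistent_core_def persistent_def)
  then obtain x r where r: "strict_mono r" "(X \<circ> r) \<longlonglongrightarrow> x"
    using compact_unit_part unfolding compact_def by blast
  have "x \<in> persistent_core l"
    using X r(2) by (intro persistent_limit[of "X \<circ> r" "\<lambda>_. l" id]) (auto simp: persistent_core_def)
  with r show "\<exists>x\<in>persistent_core l. \<exists>r. strict_mono r \<and> (X \<circ> r) \<longlonglongrightarrow> x" by blast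
qed

text \<open>Rates slightly below \<open>l\<close> and arbitrarily long horizons can be met simultaneously only near the
core: otherwise take \<open>m\<close> tending to \<open>l\<close> and \<open>N\<close> to infinity, and pass to the limit.\<close>

lemma uniformly_not_persistent:
  assumes Q: "compact Q" "Q \<inter> persistent_core l = {}" and l: "0 < l"
  shows "\<exists>m N. 0 < m \<and> m < l \<and> Q \<inter> persistent m N = {}"
proof (rule ccontr)
  assume neg: "\<not> ?thesis"
  define m where "m = (\<lambda>n. l * (1 - inverse (real (Suc (Suc n)))))"
  have m: "0 < m n" "m n < l" for n
    using l by (simp_all add: m_def field_simps add_pos_nonneg)
  have "\<exists>x. x \<in> Q \<inter> persistent (m n) n" for n using neg m by blast
  then obtain X where X: "\<And>n. X n \<in> Q \<inter> persistent (m n) n" by metis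
  then obtain x r where r: "x \<in> Q" "strict_mono r" "(X \<circ> r) \<longlonglongrightarrow> x"
    using Q(1) unfolding compact_def by (metis IntD1)
  have "m \<longlonglongrightarrow> l * (1 - 0)"
    unfolding m_def using LIMSEQ_Suc[OF LIMSEQ_inverse_real_of_nat] by (intro tendsto_intros)
  then have "m \<longlonglongrightarrow> l" by simp
  from LIMSEQ_subseq_LIMSEQ[OF this r(2)] have "x \<in> persistent_core l"
    using X r seq_suble[OF r(2)] by (intro persistent_limit[of "X \<circ> r" "m \<circ> r" r]) auto
  with r(1) Q(2) show False by blast
qed

text \<open>As long as a trajectory stays in directions from \<open>Q\<close>, it falls below the rate \<open>m\<close> at least once in
every \<open>N\<close> steps. Restarting at each such time leaves at most \<open>N\<close> uncontrolled steps at the end,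
and these are absorbed in the constant.\<close>

lemma decay_off_persistent:
  assumes m: "0 < m" and Q: "Q \<subseteq> unit_part" "Q \<inter> persistent m N = {}"
  shows "\<exists>C. \<forall>n F x. (\<forall>i. F i \<in> A) \<longrightarrow> x \<in> K \<longrightarrow>
    (\<forall>j<n. trajectory F j x \<noteq> 0 \<longrightarrow> trajectory F j x /\<^sub>R norm (trajectory F j x) \<in> Q) \<longrightarrow>
    norm (trajectory F n x) \<le> C * m ^ n * norm x"
proof -
  obtain L where L: "L \<ge> 1" "\<And>f x. f \<in> A \<Longrightarrow> x \<in> K \<Longrightarrow> norm (f x) \<le> L * norm x"
    using family_bounded by blast
  define C where "C = max 1 (L / m) ^ N"
  have C0: "C \<ge> 0" by (simp add: C_def)
  have "norm (trajectory F n x) \<le> C * m ^ n * norm x"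
    if "\<And>i. F i \<in> A" "x \<in> K"
      "\<And>j. j < n \<Longrightarrow> trajectory F j x \<noteq> 0 \<Longrightarrow> trajectory F j x /\<^sub>R norm (trajectory F j x) \<in> Q"
    for n F x
    using that
  proof (induction n arbitrary: F x rule: less_induct)
    case (less n)
    show ?case
    proof (cases "n \<le> N \<or> x = 0")
      case True
      show ?thesis
      proof (cases "x = 0")
        case True
        have "trajectory F n 0 = 0" using trajectory_cone_map[of F n] less.prems(1) cone_maps cone_map_zero by blast
        with True show ?thesis by simp
      next
        case False
        with True have nN: "n \<le> N" by simp
        have "L ^ n = (L / m) ^ n * m ^ n" using m by (simp add: power_divide)
        also have "\<dots> \<le> max 1 (L / m) ^ n * m ^ n"
          using m L(1) by (intro mult_right_mono power_mono) auto
        also have "\<dots> \<le> C * m ^ n"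
          unfolding C_def using m nN by (intro mult_right_mono power_increasing) auto
        finally have "L ^ n * norm x \<le> C * m ^ n * norm x" by (rule mult_right_mono) simp
        then show ?thesis
          using norm_trajectory_le[of L F x n] L less.prems(1,2) by (meson order_trans zero_le_one)
      qed
    next
      case False
      define u where "u = x /\<^sub>R norm x"
      have uQ: "u \<in> Q" using less.prems(3)[of 0] False by (auto simp: u_def)
      then obtain j where j: "j \<le> N" "norm (trajectory F j u) < m ^ j"
      proof -
        have "u \<in> unit_part" "u \<notin> persistent m N" using Q uQ by blast+
        then have "\<not> (\<forall>j\<le>N. m ^ j \<le> norm (trajectory F j u))"
          using less.prems(1) unfolding persistent_def by blast
        with that show ?thesis by (meson not_le)
      qed
      have "trajectory F j u = trajectory F j x /\<^sub>R norm x"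
        unfolding u_def using trajectory_cone_map[of F j] less.prems(1,2) cone_maps
        by (intro cone_map_scale) auto
      then have xj: "norm (trajectory F j x) \<le> m ^ j * norm x"
        using j(2) False by (simp add: field_simps)
      have "j \<noteq> 0" using j uQ Q(1) by (intro notI) auto
      with False j have jn: "0 < j" "j \<le> n" by auto
      define F' where "F' = (\<lambda>i. F (j + i))"
      have shift: "trajectory F (j + i) x = trajectory F' i (trajectory F j x)" for i
        by (simp add: trajectory_add F'_def)
      have "norm (trajectory F' (n - j) (trajectory F j x)) \<le> C * m ^ (n - j) * norm (trajectory F j x)"
      proof (rule less.IH)
        show "n - j < n" using jn by simp
        show "F' i \<in> A" for i using less.prems(1) by (simp add: F'_def)
        show "trajectory F j x \<in> K" using less.prems(1,2) trajectory_in by blast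
        show "trajectory F' i (trajectory F j x) /\<^sub>R norm (trajectory F' i (trajectory F j x)) \<in> Q"
          if "i < n - j" "trajectory F' i (trajectory F j x) \<noteq> 0" for i
          using less.prems(3)[of "j + i"] that by (simp add: shift)
      qed
      also have "\<dots> \<le> C * m ^ (n - j) * (m ^ j * norm x)"
        using xj C0 m by (intro mult_left_mono) auto
      also have "\<dots> = C * m ^ n * norm x"
        using jn(2) by (simp flip: power_add)
      finally show ?thesis using shift[of "n - j"] jn(2) by simp
    qed
  qed
  then show ?thesis by blast
qed

text \<open>If the core were empty, all directions would be subject to the decay estimate.\<close>

lemma persistent_core_nonempty:
  assumes l: "0 < l" and growth: "\<And>m. 0 < m \<Longrightarrow> m < l \<Longrightarrow> \<not> growth_bounded_by m"
  shows "persistent_core l \<noteq> {}"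
proof
  assume "persistent_core l = {}"
  then obtain m N where m: "0 < m" "m < l" "unit_part \<inter> persistent m N = {}"
    using uniformly_not_persistent[OF compact_unit_part _ l] by auto
  obtain C where C: "\<And>n F x. (\<And>i. F i \<in> A) \<Longrightarrow> x \<in> K \<Longrightarrow>
    (\<And>j. j < n \<Longrightarrow> trajectory F j x \<noteq> 0 \<Longrightarrow> trajectory F j x /\<^sub>R norm (trajectory F j x) \<in> unit_part) \<Longrightarrow>
    norm (trajectory F n x) \<le> C * m ^ n * norm x"
    using decay_off_persistent[OF m(1) subset_refl m(3)] by meson
  have "norm (g x) \<le> C * m ^ n * norm x" if "g \<in> family_power A n" "x \<in> K" for n g x
  proof -
    obtain F where F: "\<And>i. F i \<in> A" "g = trajectory F n"
      using family_power_trajectoryE[OF nonempty \<open>g \<in> _\<close>] by blast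
    show ?thesis unfolding F(2)
    proof (rule C)
      show "trajectory F j x /\<^sub>R norm (trajectory F j x) \<in> unit_part"
        if "trajectory F j x \<noteq> 0" for j
        using direction_in_unit_part[OF trajectory_in that] F(1) \<open>x \<in> K\<close> by blast
    qed (use F that in auto)
  qed
  with growth[OF m(1,2)] show False unfolding growth_bounded_by_def by blast
qed

text \<open>A trajectory from \<open>x\<close> that keeps growing at rate \<open>l\<close> cannot spend its whole future in directions
away from the core, where the growth has a rate below \<open>l\<close>.\<close>

lemma return_near_persistent_core:
  assumes l: "0 < l" and W: "open W" "persistent_core l \<subseteq> W" and x: "x \<in> persistent_core l"
  shows "\<exists>n>0. \<exists>g\<in>family_power A n. l ^ n \<le> norm (g x) \<and> g x /\<^sub>R norm (g x) \<in> W"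
proof (rule ccontr)
  assume neg: "\<not> ?thesis"
  have xU: "x \<in> unit_part" using x by (auto simp: persistent_core_def persistent_def)
  obtain L where L: "L \<ge> 1" "\<And>f x. f \<in> A \<Longrightarrow> x \<in> K \<Longrightarrow> norm (f x) \<le> L * norm x"
    using family_bounded by blast
  define Q where "Q = unit_part - W"
  have "compact Q" "Q \<inter> persistent_core l = {}"
    using compact_unit_part W by (auto simp: Q_def intro: compact_diff)
  then obtain m N where m: "0 < m" "m < l" "Q \<inter> persistent m N = {}"
    using uniformly_not_persistent l by blast
  have "Q \<subseteq> unit_part" by (auto simp: Q_def)
  then obtain C where C: "\<And>n F x. (\<And>i. F i \<in> A) \<Longrightarrow> x \<in> K \<Longrightarrow>
    (\<And>j. j < n \<Longrightarrow> trajectory F j x \<noteq> 0 \<Longrightarrow> trajectory F j x /\<^sub>R norm (trajectory F j x) \<in> Q) \<Longrightarrow>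
    norm (trajectory F n x) \<le> C * m ^ n * norm x"
    using decay_off_persistent[OF m(1) _ m(3)] by meson
  \<comment> \<open>The direction of \<open>x\<close> itself is in \<open>W\<close>, so the decay estimate is applied after the first step,
    at the cost of a factor \<open>L\<close>.\<close>
  have bound: "l * (l / m) ^ n \<le> C * L" for n
  proof -
    obtain F where F: "\<And>i. F i \<in> A" "\<And>j. j \<le> Suc n \<Longrightarrow> l ^ j \<le> norm (trajectory F j x)"
      using x unfolding persistent_core_def persistent_def by blast
    define y where "y = F 0 x"
    have yK: "y \<in> K" using trajectory_in[of F x 1] F(1) xU by (simp add: y_def)
    have y_norm: "norm y \<le> L" using L(2)[OF F(1), of x 0] xU by (simp add: y_def)
    define F' where "F' = (\<lambda>i. F (Suc i))"
    have shift: "trajectory F (Suc j) x = trajectory F' j y" for j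
      using trajectory_add[of F 1 j] by (simp add: y_def F'_def)
    have "norm (trajectory F' n y) \<le> C * m ^ n * norm y"
    proof (rule C)
      fix j assume j: "j < n" "trajectory F' j y \<noteq> 0"
      have "trajectory F (Suc j) \<in> family_power A (Suc j)"
        using F(1) by (intro trajectory_in_family_power)
      moreover have "l ^ Suc j \<le> norm (trajectory F (Suc j) x)" using j by (intro F(2)) simp
      ultimately have "trajectory F (Suc j) x /\<^sub>R norm (trajectory F (Suc j) x) \<notin> W"
        using neg by blast
      moreover have "trajectory F' j y /\<^sub>R norm (trajectory F' j y) \<in> unit_part"
        using j(2) F(1) yK by (intro direction_in_unit_part trajectory_in) (auto simp: F'_def)
      ultimately show "trajectory F' j y /\<^sub>R norm (trajectory F' j y) \<in> Q"
        by (simp only: Q_def shift Diff_iff) simp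
    qed (use F yK in \<open>auto simp: F'_def\<close>)
    then have upper: "l ^ Suc n \<le> C * m ^ n * norm y" using F(2)[of "Suc n"] shift[of n] by simp
    have "0 < C * m ^ n * norm y" using l by (intro less_le_trans[OF _ upper]) simp
    then have "C \<ge> 0" using m(1) by (simp add: zero_less_mult_iff)
    then have "C * m ^ n * norm y \<le> C * m ^ n * L"
      using y_norm m(1) by (intro mult_left_mono) auto
    with upper have "l ^ Suc n \<le> C * m ^ n * L" by simp
    then show ?thesis using m(1) by (simp add: power_divide field_simps)
  qed
  have "l / m > 1" using m by simp
  then obtain n where "C * L / l < (l / m) ^ n" using real_arch_pow by blast
  with bound[of n] l show False by (simp add: field_simps)
qed

end

locale compact_polyhedral_family = closed_polyhedral_cone K + compact_cone_family K A
  for K :: "'a::real_normed_vector set" and A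
begin

text \<open>The core of the proof. Around each point \<open>p\<close> of the persistent core there is a ball whose points
in \<open>K\<close> dominate \<open>(c / l) *\<^sub>R p\<close>. Finitely many of these balls cover the core. From each of their
centres \<open>p\<close> some composition \<open>g\<close> leads back, with growth at rate \<open>l\<close>, into the ball of a centre \<open>q\<close>,
and then \<open>g p\<close> dominates \<open>c ^ n *\<^sub>R q\<close>. By monotonicity and homogeneity this relation between centres
is transitive. Among finitely many centres it must contain a cycle, and a cycle gives the required map.\<close>

theorem growth_realized:
  assumes c: "0 < c" "c < l" and growth: "\<And>m. 0 < m \<Longrightarrow> m < l \<Longrightarrow> \<not> growth_bounded_by m"
  shows "\<exists>n>0. \<exists>g\<in>family_power A n. \<exists>p\<in>K. p \<noteq> 0 \<and> g p - c ^ n *\<^sub>R p \<in> K"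
proof -
  have l: "0 < l" using c by simp
  define G where "G = persistent_core l"
  have GK: "p \<in> K" "p \<noteq> 0" if "p \<in> G" for p
    using that by (auto simp: G_def persistent_core_def persistent_def)
  have "\<exists>d>0. \<forall>y\<in>K. dist p y < d \<longrightarrow> y - (c / l) *\<^sub>R p \<in> K" if "p \<in> G" for p
    using order_lower_semicontinuous[OF GK(1)[OF that], of "c / l"] c by simp
  then obtain d where d: "\<And>p. p \<in> G \<Longrightarrow> d p > 0"
    "\<And>p y. p \<in> G \<Longrightarrow> y \<in> K \<Longrightarrow> dist p y < d p \<Longrightarrow> y - (c / l) *\<^sub>R p \<in> K" by metis
  have "G \<subseteq> (\<Union>p\<in>G. ball p (d p))" using d(1) by auto
  then obtain P where P: "P \<subseteq> G" "finite P" "G \<subseteq> (\<Union>p\<in>P. ball p (d p))"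
    using compactE_image[OF compact_persistent_core[of l, folded G_def], of G "\<lambda>p. ball p (d p)"] by auto
  define W where "W = (\<Union>p\<in>P. ball p (d p))"
  define R where "R = (\<lambda>p q. \<exists>n>0. \<exists>g\<in>family_power A n. g p - c ^ n *\<^sub>R q \<in> K)"
  have step: "\<exists>q. q \<in> P \<and> R p q" if "p \<in> P" for p
  proof -
    have pG: "p \<in> G" using that P(1) by blast
    obtain n g where g: "n > 0" "g \<in> family_power A n" "l ^ n \<le> norm (g p)" "g p /\<^sub>R norm (g p) \<in> W"
      using return_near_persistent_core[OF l, of W p] P(3) pG by (auto simp: W_def G_def)
    then obtain q where q: "q \<in> P" "dist q (g p /\<^sub>R norm (g p)) < d q" by (auto simp: W_def)
    have qG: "q \<in> G" using q(1) P(1) by blast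
    have gpK: "g p \<in> K"
      using g(2) family_power_cone_maps[OF cone_maps] GK(1)[OF pG] cone_map_in by blast
    have gp0: "norm (g p) > 0" using g(3) l by (meson less_le_trans zero_less_power)
    have "g p /\<^sub>R norm (g p) - (c / l) *\<^sub>R q \<in> K"
      using gpK q(2) by (intro d(2)[OF qG] scale_in) auto
    moreover have "g p - norm (g p) *\<^sub>R (g p /\<^sub>R norm (g p)) \<in> K" using gp0 zero_in by simp
    ultimately have "g p - (norm (g p) * (c / l)) *\<^sub>R q \<in> K"
      by (rule diff_scale_trans) simp
    \<comment> \<open>The single factor \<open>c / l\<close> lost at the ball is affordable because \<open>n \<ge> 1\<close>.\<close>
    moreover have "c ^ n \<le> norm (g p) * (c / l)"
    proof -
      have "c ^ n = c ^ (n - 1) * c" using g(1) by (metis Suc_diff_1 power_Suc2)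
      also have "\<dots> \<le> l ^ (n - 1) * c" using c by (intro mult_right_mono power_mono) auto
      also have "\<dots> = l ^ n * (c / l)" using g(1) l by (cases n) auto
      also have "\<dots> \<le> norm (g p) * (c / l)" using g(3) c by (intro mult_right_mono) auto
      finally show ?thesis .
    qed
    ultimately have "g p - c ^ n *\<^sub>R q \<in> K" using diff_scale_weaken GK(1)[OF qG] by blast
    with g(1,2) q(1) show ?thesis unfolding R_def by blast
  qed
  have trans: "R p t" if "R p q" "R q t" "p \<in> K" "q \<in> K" for p q t
  proof -
    obtain n g where g: "n > 0" "g \<in> family_power A n" "g p - c ^ n *\<^sub>R q \<in> K"
      using \<open>R p q\<close> R_def by blast
    obtain k h where h: "k > 0" "h \<in> family_power A k" "h q - c ^ k *\<^sub>R t \<in> K"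
      using \<open>R q t\<close> R_def by blast
    have hc: "h \<in> cone_maps K" and gc: "g \<in> cone_maps K"
      using h g family_power_cone_maps[OF cone_maps] by blast+
    have "h (g p) - h (c ^ n *\<^sub>R q) \<in> K"
      using c by (intro cone_map_mono[OF hc] cone_map_in[OF gc] scale_in that(3,4) g(3)) simp
    then have "h (g p) - c ^ n *\<^sub>R h q \<in> K" using cone_map_scale[OF hc \<open>q \<in> K\<close>] c by simp
    then have "h (g p) - (c ^ n * c ^ k) *\<^sub>R t \<in> K"
      using h(3) c by (intro diff_scale_trans[of "h q"]) auto
    moreover have "h \<circ> g \<in> family_power A (k + n)" using family_power_comp g h by blast
    ultimately show "R p t"
      using g(1) unfolding R_def
      by (intro exI[of _ "k + n"] conjI bexI[of _ "h \<circ> g"]) (simp_all add: power_add mult.commute)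
  qed
  have "\<exists>p\<in>P. R p p"
  proof (rule ccontr)
    assume "\<not> (\<exists>p\<in>P. R p p)"
    have "P = {}"
    proof (rule finite_transitivity_chain[OF P(2), where R = "\<lambda>p q. p \<in> P \<and> q \<in> P \<and> R p q"])
      show "\<not> (x \<in> P \<and> x \<in> P \<and> R x x)" for x using \<open>\<not> _\<close> by blast
      show "x \<in> P \<and> z \<in> P \<and> R x z" if "x \<in> P \<and> y \<in> P \<and> R x y" "y \<in> P \<and> z \<in> P \<and> R y z" for x y z
        using that trans[of x y z] GK(1) P(1) by blast
      show "\<exists>y. y \<in> P \<and> x \<in> P \<and> y \<in> P \<and> R x y" if "x \<in> P" for x using step[OF that] that by blast
    qed
    with P(3) persistent_core_nonempty[OF l growth] show False by (auto simp: G_def)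
  qed
  with GK P(1) show ?thesis unfolding R_def by blast
qed

end



section \<open>The cone spectral radius\<close>

text \<open>Fekete's lemma, in multiplicative form and allowing zeros.\<close>

lemma submultiplicative_root_convergent:
  fixes a :: "nat \<Rightarrow> real"
  assumes nonneg: "\<And>n. 0 \<le> a n" and sub: "\<And>m n. a (m + n) \<le> a m * a n"
  shows "convergent (\<lambda>n. root n (a n))"
proof -
  define l where "l = (INF n\<in>{1..}. root n (a n))"
  have bdd: "bdd_below ((\<lambda>n. root n (a n)) ` {1..})"
    using nonneg by (intro bdd_belowI[of _ 0]) auto
  have lower: "l \<le> root n (a n)" if "n \<ge> 1" for n
    unfolding l_def using that bdd by (intro cINF_lower) auto
  have "l \<ge> 0" unfolding l_def using nonneg by (intro cINF_greatest) auto
  have upper: "\<forall>\<^sub>F n in sequentially. root n (a n) < b" if "l < b" for b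
  proof -
    obtain c where c: "l < c" "c < b" using \<open>l < b\<close> dense by blast
    then have c0: "c > 0" using \<open>l \<ge> 0\<close> by simp
    obtain k where k: "k \<ge> 1" "root k (a k) < c"
      using c(1) cInf_lessD[of "(\<lambda>n. root n (a n)) ` {1..}" c] unfolding l_def by auto
    have "a k = root k (a k) ^ k" using k(1) nonneg by simp
    also have "\<dots> \<le> c ^ k" using k nonneg by (intro power_mono) auto
    finally have ak: "a k \<le> c ^ k" .
    have steps: "a (k * q + s) \<le> c ^ (k * q) * a s" for q s
    proof (induction q)
      case (Suc q)
      have "a (k * Suc q + s) \<le> a k * a (k * q + s)"
        using sub[of k "k * q + s"] by (simp add: algebra_simps)
      also have "\<dots> \<le> c ^ k * (c ^ (k * q) * a s)"
        using Suc ak nonneg c0 by (intro mult_mono) auto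
      finally show ?case by (simp add: power_add algebra_simps)
    qed simp
    define C where "C = 1 + (\<Sum>s<k. a s / c ^ s)"
    have C1: "C \<ge> 1" unfolding C_def using nonneg c0 by (simp add: sum_nonneg)
    have aC: "a n \<le> C * c ^ n" for n
    proof -
      define q s where "q = n div k" and "s = n mod k"
      have n: "n = k * q + s" and "s < k" using k(1) by (auto simp: q_def s_def)
      have "a s / c ^ s \<le> (\<Sum>s<k. a s / c ^ s)"
        using \<open>s < k\<close> nonneg c0 by (intro member_le_sum) auto
      then have "a s / c ^ s \<le> C" by (simp add: C_def)
      then have "a s \<le> C * c ^ s" using c0 by (simp add: field_simps)
      then have "c ^ (k * q) * a s \<le> c ^ (k * q) * (C * c ^ s)" using c0 by (intro mult_left_mono) auto
      with steps[of q s] show ?thesis by (simp add: n power_add algebra_simps)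
    qed
    have "(\<lambda>n. root n C * c) \<longlonglongrightarrow> 1 * c"
      using C1 by (intro tendsto_intros LIMSEQ_root_const) auto
    then have "\<forall>\<^sub>F n in sequentially. root n C * c < b" using c(2) by (intro order_tendstoD) auto
    with eventually_gt_at_top[of 0] show ?thesis
    proof eventually_elim
      case (elim n)
      have "root n (a n) \<le> root n (C * c ^ n)" using elim aC by (intro real_root_le_mono) auto
      also have "\<dots> = root n C * c" using elim c0 by (simp add: real_root_mult real_root_power_cancel)
      finally show ?case using elim by simp
    qed
  qed
  have "(\<lambda>n. root n (a n)) \<longlonglongrightarrow> l"
  proof (rule order_tendstoI)
    fix b assume "b < l"
    show "\<forall>\<^sub>F n in sequentially. b < root n (a n)"
      using eventually_ge_at_top[of 1] by eventually_elim (use lower \<open>b < l\<close> in fastforce)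
  qed (rule upper)
  then show ?thesis by (rule convergentI)
qed

locale nonzero_closed_cone = closed_cone +
  assumes nonzero: "K \<noteq> {0}"
begin

lemma unit_part_nonempty: "unit_part \<noteq> {}"
proof -
  obtain x where "x \<in> K" "x \<noteq> 0" using nonzero zero_in by blast
  from direction_in_unit_part[OF this] show ?thesis by blast
qed

lemma bdd_above_unit_part:
  assumes "f \<in> cone_maps K" shows "bdd_above ((\<lambda>x. norm (f x)) ` unit_part)"
proof -
  have "continuous_on K f" using assms by (simp add: cone_maps_def)
  then have "continuous_on unit_part f" by (rule continuous_on_subset) auto
  then have "continuous_on unit_part (\<lambda>x. norm (f x))" by (rule continuous_on_norm)
  from compact_continuous_image[OF this compact_unit_part] show ?thesis
    by (intro bounded_imp_bdd_above compact_imp_bounded)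
qed

lemma norm_le_cone_norm:
  assumes "f \<in> cone_maps K" "x \<in> K" shows "norm (f x) \<le> cone_norm K f * norm x"
proof (cases "x = 0")
  case True with cone_map_zero[OF assms(1)] show ?thesis by simp
next
  case False
  define u where "u = x /\<^sub>R norm x"
  have u: "u \<in> unit_part" using direction_in_unit_part[OF assms(2) False] by (simp only: u_def)
  then have "norm (f u) \<le> cone_norm K f"
    unfolding cone_norm_def by (intro cSUP_upper bdd_above_unit_part[OF assms(1)])
  moreover have "f u = f x /\<^sub>R norm x" unfolding u_def by (intro cone_map_scale[OF assms]) simp
  ultimately show ?thesis using False by (simp add: field_simps)
qed

lemma cone_norm_le: "(\<And>x. x \<in> unit_part \<Longrightarrow> norm (f x) \<le> c) \<Longrightarrow> cone_norm K f \<le> c"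
  unfolding cone_norm_def using unit_part_nonempty by (intro cSUP_least) auto

lemma cone_norm_nonneg: assumes "f \<in> cone_maps K" shows "0 \<le> cone_norm K f"
proof -
  obtain x where "x \<in> unit_part" using unit_part_nonempty by blast
  then show ?thesis using norm_le_cone_norm[OF assms, of x] norm_ge_zero[of "f x"]
    by (auto intro: order_trans[OF norm_ge_zero])
qed

lemma cone_norm_comp:
  assumes f: "f \<in> cone_maps K" and g: "g \<in> cone_maps K"
  shows "cone_norm K (f \<circ> g) \<le> cone_norm K f * cone_norm K g"
proof (rule cone_norm_le)
  fix x assume x: "x \<in> unit_part"
  have "norm ((f \<circ> g) x) \<le> cone_norm K f * norm (g x)"
    using norm_le_cone_norm[OF f] cone_map_in[OF g] x by simp
  also have "\<dots> \<le> cone_norm K f * (cone_norm K g * norm x)"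
    using x by (intro mult_left_mono norm_le_cone_norm[OF g] cone_norm_nonneg[OF f]) simp
  finally show "norm ((f \<circ> g) x) \<le> cone_norm K f * cone_norm K g" using x by simp
qed

lemma cone_spectral_radius_LIMSEQ:
  assumes f: "f \<in> cone_maps K"
  shows "(\<lambda>n. root n (cone_norm K (f ^^ n))) \<longlonglongrightarrow> cone_spectral_radius K f"
proof -
  have "convergent (\<lambda>n. root n (cone_norm K (f ^^ n)))"
    using funpow_cone_map[OF f]
    by (intro submultiplicative_root_convergent) (auto simp: funpow_add cone_norm_nonneg cone_norm_comp)
  then show ?thesis unfolding cone_spectral_radius_def by (simp add: convergent_LIMSEQ_iff)
qed

lemma cone_spectral_radius_nonneg:
  assumes "f \<in> cone_maps K" shows "0 \<le> cone_spectral_radius K f"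
proof (rule LIMSEQ_le_const[OF cone_spectral_radius_LIMSEQ[OF assms]])
  show "\<exists>N. \<forall>n\<ge>N. 0 \<le> root n (cone_norm K (f ^^ n))"
    using cone_norm_nonneg[OF funpow_cone_map[OF assms]] by (auto intro: real_root_ge_zero)
qed

lemma cone_spectral_radius_le_norm:
  assumes f: "f \<in> cone_maps K" shows "cone_spectral_radius K f \<le> cone_norm K f"
proof (rule LIMSEQ_le_const2[OF cone_spectral_radius_LIMSEQ[OF f]])
  have pow: "cone_norm K (f ^^ n) \<le> cone_norm K f ^ n" for n
  proof (induction n)
    case 0
    show ?case by (rule cone_norm_le) auto
  next
    case (Suc n)
    have "cone_norm K (f ^^ Suc n) \<le> cone_norm K f * cone_norm K (f ^^ n)"
      using cone_norm_comp[OF f funpow_cone_map[OF f, of n]] by simp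
    also have "\<dots> \<le> cone_norm K f * cone_norm K f ^ n"
      using Suc cone_norm_nonneg[OF f] by (rule mult_left_mono)
    finally show ?case by (simp only: power_Suc)
  qed
  have "root n (cone_norm K (f ^^ n)) \<le> cone_norm K f" if "n \<ge> 1" for n
  proof -
    have "root n (cone_norm K (f ^^ n)) \<le> root n (cone_norm K f ^ n)"
      using that pow by (intro real_root_le_mono) auto
    then show ?thesis using that cone_norm_nonneg[OF f] by (simp add: real_root_power_cancel)
  qed
  then show "\<exists>N. \<forall>n\<ge>N. root n (cone_norm K (f ^^ n)) \<le> cone_norm K f" by blast
qed

lemma funpow_superfixed:
  assumes f: "f \<in> cone_maps K" and p: "p \<in> K" "f p - c *\<^sub>R p \<in> K" "0 \<le> c"
  shows "(f ^^ n) p - c ^ n *\<^sub>R p \<in> K"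
proof (induction n)
  case 0 then show ?case using zero_in by simp
next
  case (Suc n)
  have "f ((f ^^ n) p) - f (c ^ n *\<^sub>R p) \<in> K"
    using Suc p by (intro cone_map_mono[OF f] cone_map_in[OF funpow_cone_map[OF f]] scale_in) auto
  then have "f ((f ^^ n) p) - c ^ n *\<^sub>R f p \<in> K" using cone_map_scale[OF f p(1)] p(3) by simp
  from diff_scale_trans[OF p(2) this] p(3) show ?case by (simp add: mult.commute)
qed

text \<open>If \<open>f p\<close> dominates \<open>c *\<^sub>R p\<close>, then the iterates dominate the powers of \<open>c\<close>, and by normality so do
their norms, up to a constant that disappears in the root.\<close>

lemma cone_spectral_radius_ge:
  assumes f: "f \<in> cone_maps K" and p: "p \<in> K" "p \<noteq> 0" "f p - c *\<^sub>R p \<in> K" and c: "0 \<le> c"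
  shows "c \<le> cone_spectral_radius K f"
proof -
  obtain M where M: "M > 0" "\<And>x y. x \<in> K \<Longrightarrow> y - x \<in> K \<Longrightarrow> norm x \<le> M * norm y"
    using normality by blast
  have lower: "c ^ n / M \<le> cone_norm K (f ^^ n)" for n
  proof -
    have "norm (c ^ n *\<^sub>R p) \<le> M * norm ((f ^^ n) p)"
      using funpow_superfixed[OF f p(1,3) c] scale_in[OF p(1)] c by (intro M(2)) auto
    also have "\<dots> \<le> M * (cone_norm K (f ^^ n) * norm p)"
      using norm_le_cone_norm[OF funpow_cone_map[OF f] p(1)] M(1) by (intro mult_left_mono) auto
    finally show ?thesis using p(2) M(1) c by (simp add: field_simps)
  qed
  have "(\<lambda>n. c * root n (1 / M)) \<longlonglongrightarrow> c * 1"
    using M(1) by (intro tendsto_intros LIMSEQ_root_const) auto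
  then have "c * 1 \<le> cone_spectral_radius K f"
  proof (rule LIMSEQ_le[OF _ cone_spectral_radius_LIMSEQ[OF f]])
    have "c * root n (1 / M) \<le> root n (cone_norm K (f ^^ n))" if "n \<ge> 1" for n
    proof -
      have "c * root n (1 / M) = root n (c ^ n / M)"
        using that c by (simp add: real_root_divide real_root_power_cancel)
      also have "\<dots> \<le> root n (cone_norm K (f ^^ n))"
        using that lower by (intro real_root_le_mono) auto
      finally show ?thesis .
    qed
    then show "\<exists>N. \<forall>n\<ge>N. c * root n (1 / M) \<le> root n (cone_norm K (f ^^ n))" by blast
  qed
  then show ?thesis by simp
qed

section \<open>Bounds for the generalized spectral radius\<close>

lemma generalized_spectral_radius_nonneg:
  assumes "A \<noteq> {}" "A \<subseteq> cone_maps K" shows "0 \<le> generalized_spectral_radius K A"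
  unfolding generalized_spectral_radius_def
proof (rule le_Limsup)
  obtain a where "a \<in> A" using assms(1) by blast
  show "\<forall>\<^sub>F m in sequentially. 0 \<le> (SUP f\<in>family_power A m. ereal (root m (cone_spectral_radius K f)))"
  proof (intro always_eventually allI)
    fix m
    have g: "trajectory (\<lambda>_. a) m \<in> family_power A m"
      using \<open>a \<in> A\<close> by (intro trajectory_in_family_power)
    then have "0 \<le> root m (cone_spectral_radius K (trajectory (\<lambda>_. a) m))"
      using family_power_cone_maps[OF assms(2)] cone_spectral_radius_nonneg
      by (intro real_root_ge_zero) blast
    with g show "0 \<le> (SUP f\<in>family_power A m. ereal (root m (cone_spectral_radius K f)))"
      by (intro SUP_upper2[OF g]) simp
  qed
qed simp

text \<open>The upper limit is bounded from below along the multiples of \<open>n\<close>, by means of the iterates of \<open>g\<close>.\<close>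

lemma generalized_spectral_radius_ge:
  assumes A: "A \<subseteq> cone_maps K" and g: "g \<in> family_power A n" "n > 0"
    and p: "p \<in> K" "p \<noteq> 0" "g p - c ^ n *\<^sub>R p \<in> K" and c: "0 < c"
  shows "ereal c \<le> generalized_spectral_radius K A"
proof (rule ccontr)
  assume "\<not> ?thesis"
  then have "\<forall>\<^sub>F m in sequentially. (SUP f\<in>family_power A m. ereal (root m (cone_spectral_radius K f))) < c"
    unfolding generalized_spectral_radius_def not_le by (rule Limsup_lessD)
  then obtain m0 where m0: "\<And>m. m \<ge> m0 \<Longrightarrow> (SUP f\<in>family_power A m. ereal (root m (cone_spectral_radius K f))) < c"
    unfolding eventually_sequentially by blast
  define k where "k = Suc m0"
  have nk: "n * k \<ge> m0" "n * k > 0" using g(2) by (cases n; simp add: k_def)+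
  have gc: "g \<in> cone_maps K" using family_power_cone_maps[OF A] g(1) by blast
  have "(g ^^ k) p - (c ^ n) ^ k *\<^sub>R p \<in> K" using funpow_superfixed[OF gc p(1,3)] c by simp
  then have "c ^ (n * k) \<le> cone_spectral_radius K (g ^^ k)"
    using cone_spectral_radius_ge[OF funpow_cone_map[OF gc] p(1,2)] c by (simp add: power_mult)
  then have "root (n * k) (c ^ (n * k)) \<le> root (n * k) (cone_spectral_radius K (g ^^ k))"
    using nk(2) by (intro real_root_le_mono)
  then have "c \<le> root (n * k) (cone_spectral_radius K (g ^^ k))"
    using nk(2) c by (simp only: real_root_power_cancel)
  then have "ereal c \<le> (SUP f\<in>family_power A (n * k). ereal (root (n * k) (cone_spectral_radius K f)))"
    by (intro SUP_upper2[OF family_power_funpow[OF g(1), of k]]) simp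
  with m0[OF nk(1)] show False by simp
qed

lemma generalized_spectral_radius_le:
  assumes A: "A \<subseteq> cone_maps K" and m: "0 < m"
    and growth: "\<And>n g x. g \<in> family_power A n \<Longrightarrow> x \<in> K \<Longrightarrow> norm (g x) \<le> C * m ^ n * norm x"
  shows "generalized_spectral_radius K A \<le> ereal m"
proof -
  define D where "D = max C 1"
  have D: "0 < D" by (simp add: D_def)
  have "(\<lambda>n. ereal (root n D * m)) \<longlonglongrightarrow> ereal (1 * m)"
    using D by (intro tendsto_intros LIMSEQ_root_const)
  from lim_imp_Limsup[OF sequentially_bot this]
  have lim: "limsup (\<lambda>n. ereal (root n D * m)) = ereal m" by simp
  have "(SUP f\<in>family_power A n. ereal (root n (cone_spectral_radius K f))) \<le> ereal (root n D * m)"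
    if "n > 0" for n
  proof (rule SUP_least)
    fix g assume g: "g \<in> family_power A n"
    then have gc: "g \<in> cone_maps K" using family_power_cone_maps[OF A] by blast
    have "cone_norm K g \<le> D * m ^ n"
    proof (rule cone_norm_le)
      fix x assume "x \<in> unit_part"
      then have "norm (g x) \<le> C * m ^ n" using growth[OF g, of x] by simp
      also have "\<dots> \<le> D * m ^ n" using m by (intro mult_right_mono) (auto simp: D_def)
      finally show "norm (g x) \<le> D * m ^ n" .
    qed
    then have "root n (cone_spectral_radius K g) \<le> root n (D * m ^ n)"
      using cone_spectral_radius_le_norm[OF gc] that by (intro real_root_le_mono) auto
    then show "ereal (root n (cone_spectral_radius K g)) \<le> ereal (root n D * m)"
      using that m by (simp add: real_root_mult real_root_power_cancel)
  qed
  then have "generalized_spectral_radius K A \<le> limsup (\<lambda>n. ereal (root n D * m))"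
    unfolding generalized_spectral_radius_def
    by (intro Limsup_mono eventually_mono[OF eventually_gt_at_top[of 0]])
  then show ?thesis by (simp add: lim)
qed

end



section \<open>Compactness and Hausdorff distance for families of maps\<close>

text \<open>Compactness makes the suprema and infima in the real-valued definition of the Hausdorff distance
bounded, so that they have their usual meaning.\<close>

lemma hausdorff_approximation:
  assumes S: "compactin (mtopology_of M) S" "S \<noteq> {}" and T: "compactin (mtopology_of M) T" "T \<noteq> {}"
    and e: "hausdorff_distance M S T < e"
  shows "s \<in> S \<Longrightarrow> \<exists>t\<in>T. mdist M s t < e" and "t \<in> T \<Longrightarrow> \<exists>s\<in>S. mdist M s t < e"
proof -
  interpret Metric_space "mspace M" "mdist M" by (rule Metric_space_mspace_mdist)
  have "compactin mtopology (S \<union> T)"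
    using S(1) T(1) by (intro compactin_Un) (auto simp: mtopology_of_def)
  then have "mbounded (S \<union> T)" by (rule compactin_imp_mbounded)
  then obtain B where B: "\<And>x y. x \<in> S \<union> T \<Longrightarrow> y \<in> S \<union> T \<Longrightarrow> mdist M x y \<le> B"
    unfolding mbounded_alt by blast
  have bddT: "bdd_below ((\<lambda>t. mdist M s t) ` T)" for s by (intro bdd_belowI[of _ 0]) auto
  have bddS: "bdd_below ((\<lambda>s. mdist M s t) ` S)" for t by (intro bdd_belowI[of _ 0]) auto
  obtain s0 t0 where s0: "s0 \<in> S" and t0: "t0 \<in> T" using S(2) T(2) by blast
  have bdd1: "bdd_above ((\<lambda>s. INF t\<in>T. mdist M s t) ` S)"
  proof (intro bdd_aboveI2[where M = B])
    fix s assume "s \<in> S"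
    then show "(INF t\<in>T. mdist M s t) \<le> B"
      using t0 B by (intro cINF_lower2[OF bddT t0]) auto
  qed
  have bdd2: "bdd_above ((\<lambda>t. INF s\<in>S. mdist M s t) ` T)"
  proof (intro bdd_aboveI2[where M = B])
    fix t assume "t \<in> T"
    then show "(INF s\<in>S. mdist M s t) \<le> B"
      using s0 B by (intro cINF_lower2[OF bddS s0]) auto
  qed
  show "\<exists>t\<in>T. mdist M s t < e" if "s \<in> S" for s
  proof -
    have "(INF t\<in>T. mdist M s t) \<le> hausdorff_distance M S T"
      unfolding hausdorff_distance_def using that bdd1 by (intro max.coboundedI1 cSUP_upper)
    with e cINF_less_iff[OF T(2) bddT, of s e] show ?thesis by auto
  qed
  show "\<exists>s\<in>S. mdist M s t < e" if "t \<in> T" for t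
  proof -
    have "(INF s\<in>S. mdist M s t) \<le> hausdorff_distance M S T"
      unfolding hausdorff_distance_def using that bdd2 by (intro max.coboundedI2 cSUP_upper)
    with e cINF_less_iff[OF S(2) bddS, of t e] show ?thesis by auto
  qed
qed

lemma norm_diff_le_C_mdist:
  assumes A: "compact_family K A" "f \<in> A" and B: "compact_family K B" "g \<in> B" and x: "x \<in> cone_ball K"
  shows "norm (f x - g x) \<le> mdist (C_metric K) (restrict f (cone_ball K)) (restrict g (cone_ball K))"
proof -
  have in_space: "restrict h (cone_ball K) \<in> mspace (C_metric K)" if "compact_family K D" "h \<in> D" for D h
    using compactin_subset_topspace[of "mtopology_of (C_metric K)" "restrict_family K D"] that
    by (auto simp: compact_family_def restrict_family_def)
  have "mdist euclidean_metric (restrict f (cone_ball K) x) (restrict g (cone_ball K) x)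
      \<le> mdist (C_metric K) (restrict f (cone_ball K)) (restrict g (cone_ball K))"
    unfolding C_metric_def
    by (rule mdist_cfunspace_imp_mdist_le[OF in_space[OF A, unfolded C_metric_def]
          in_space[OF B, unfolded C_metric_def] order_refl]) (simp add: x)
  then show ?thesis using x by (simp add: dist_norm)
qed

lemma (in closed_cone) compact_cone_familyI:
  assumes A: "A \<noteq> {}" "A \<subseteq> cone_maps K" "compact_family K A"
  shows "compact_cone_family K A"
proof
  fix F :: "nat \<Rightarrow> 'a \<Rightarrow> 'a" assume F: "\<And>n. F n \<in> A"
  interpret M: Metric_space "mspace (C_metric K)" "mdist (C_metric K)" by (rule Metric_space_mspace_mdist)
  have "range (\<lambda>n. restrict (F n) (cone_ball K)) \<subseteq> restrict_family K A"
    using F by (auto simp: restrict_family_def)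
  then obtain l r where l: "l \<in> restrict_family K A" "strict_mono r"
    "limitin M.mtopology ((\<lambda>n. restrict (F n) (cone_ball K)) \<circ> r) l sequentially"
    using A(3) unfolding compact_family_def mtopology_of_def M.compactin_sequentially by blast
  then obtain f where f: "f \<in> A" "l = restrict f (cone_ball K)" by (auto simp: restrict_family_def)
  define e where "e = (\<lambda>n. mdist (C_metric K) (restrict (F (r n)) (cone_ball K)) (restrict f (cone_ball K)))"
  have "e \<longlonglongrightarrow> 0"
    using l(3) unfolding M.limitin_metric_dist_null by (simp add: e_def f(2) o_def)
  moreover have "norm (F (r n) x - f x) \<le> e n" if "x \<in> cone_ball K" for n x
    unfolding e_def by (rule norm_diff_le_C_mdist[OF A(3) F A(3) f(1) that])
  ultimately show "\<exists>f\<in>A. \<exists>r e. strict_mono r \<and> e \<longlonglongrightarrow> (0::real) \<and>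
      (\<forall>n. \<forall>x\<in>cone_ball K. norm (F (r n) x - f x) \<le> e n)"
    using f(1) l(2) by blast
qed (use A in auto)

section \<open>Continuity of the generalized spectral radius\<close>

lemma (in closed_cone) trajectory_tendsto:
  assumes F: "\<And>k i. F k i \<in> cone_maps K" and G: "\<And>i. G i \<in> cone_maps K"
    and close: "\<And>k i x. x \<in> cone_ball K \<Longrightarrow> norm (F k i x - G i x) \<le> e k" "e \<longlonglongrightarrow> 0"
    and x: "x \<in> K"
  shows "(\<lambda>k. trajectory (F k) n x) \<longlonglongrightarrow> trajectory G n x"
proof (induction n)
  case (Suc n)
  have "(\<lambda>k. F k n (trajectory (F k) n x)) \<longlonglongrightarrow> G n (trajectory G n x)"
  proof (rule tendsto_cone_map[where f = "\<lambda>k. F k n" and g = "G n"])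
    show "trajectory (F k) n x \<in> K" for k using trajectory_cone_map[of "F k" n] F x cone_map_in by blast
  qed (use F G close Suc in auto)
  then show ?case by simp
qed simp

context compact_cone_family
begin

text \<open>A bound on the compositions of one length controls all lengths, by cutting a composition into blocks.\<close>

lemma growth_bounded_by_of_power:
  assumes n: "n > 0" and m: "m > 0"
    and power: "\<And>g x. g \<in> family_power A n \<Longrightarrow> x \<in> K \<Longrightarrow> norm (g x) \<le> m ^ n * norm x"
  shows "growth_bounded_by m"
proof -
  obtain L where L: "L \<ge> 1" "\<And>f x. f \<in> A \<Longrightarrow> x \<in> K \<Longrightarrow> norm (f x) \<le> L * norm x"
    using family_bounded by blast
  define C where "C = max 1 (L / m) ^ n"
  have "norm (g x) \<le> C * m ^ N * norm x" if g: "g \<in> family_power A N" and x: "x \<in> K" for N g x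
  proof -
    obtain F where F: "\<And>i. F i \<in> A" "g = trajectory F N"
      using family_power_trajectoryE[OF nonempty g] by blast
    have blocks: "norm (trajectory F (n * q) x) \<le> m ^ (n * q) * norm x" for q
    proof (induction q)
      case (Suc q)
      have "trajectory (\<lambda>i. F (n * q + i)) n \<in> family_power A n"
        using F(1) by (intro trajectory_in_family_power)
      then have "norm (trajectory F (n * q + n) x) \<le> m ^ n * norm (trajectory F (n * q) x)"
        using power trajectory_in[of F x "n * q"] F(1) x by (simp add: trajectory_add)
      also have "\<dots> \<le> m ^ n * (m ^ (n * q) * norm x)" using Suc m by (intro mult_left_mono) auto
      finally show ?case by (simp add: power_add algebra_simps)
    qed simp
    define q s where "q = N div n" and "s = N mod n"
    have N: "N = n * q + s" and "s < n" using n by (auto simp: q_def s_def)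
    have "norm (g x) \<le> L ^ s * norm (trajectory F (n * q) x)"
      using norm_trajectory_le[of L "\<lambda>i. F (n * q + i)" "trajectory F (n * q) x" s] L F trajectory_in[of F x "n * q"] x
      by (simp add: N trajectory_add)
    also have "\<dots> \<le> L ^ s * (m ^ (n * q) * norm x)" using blocks L(1) by (intro mult_left_mono) auto
    also have "L ^ s = (L / m) ^ s * m ^ s" using m by (simp add: power_divide)
    also have "(L / m) ^ s * m ^ s * (m ^ (n * q) * norm x) = (L / m) ^ s * (m ^ N * norm x)"
      by (simp add: N power_add algebra_simps)
    also have "\<dots> \<le> C * (m ^ N * norm x)"
    proof (rule mult_right_mono)
      have "(L / m) ^ s \<le> max 1 (L / m) ^ s" using L(1) m by (intro power_mono) auto
      also have "\<dots> \<le> C" unfolding C_def using \<open>s < n\<close> by (intro power_increasing) auto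
      finally show "(L / m) ^ s \<le> C" .
    qed (use m in auto)
    finally show ?thesis by (simp add: mult.assoc)
  qed
  then show ?thesis unfolding growth_bounded_by_def by blast
qed

text \<open>Norms of compositions of a fixed length depend upper semicontinuously on the family: compositions
violating the bound along the sequence would accumulate at a composition of members of \<open>A\<close> that violates it.\<close>

lemma power_bound_upper_semicontinuous:
  assumes A': "\<And>k. A' k \<noteq> {}" "\<And>k. A' k \<subseteq> cone_maps K"
    and close: "\<And>k f. f \<in> A' k \<Longrightarrow> \<exists>g\<in>A. \<forall>x\<in>cone_ball K. norm (f x - g x) \<le> e k" "e \<longlonglongrightarrow> 0"
    and bound: "\<And>g x. g \<in> family_power A n \<Longrightarrow> x \<in> unit_part \<Longrightarrow> norm (g x) < b"
  shows "\<forall>\<^sub>F k in sequentially. \<forall>f\<in>family_power (A' k) n. \<forall>x\<in>unit_part. norm (f x) < b"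
proof (rule ccontr)
  assume "\<not> ?thesis"
  then have "\<exists>k f x. j \<le> k \<and> f \<in> family_power (A' k) n \<and> x \<in> unit_part \<and> b \<le> norm (f x)" for j
    unfolding eventually_sequentially by (meson not_le)
  then obtain s where "\<exists>f x. j \<le> s j \<and> f \<in> family_power (A' (s j)) n \<and> x \<in> unit_part \<and> b \<le> norm (f x)" for j
    by metis
  then obtain f where "\<exists>x. j \<le> s j \<and> f j \<in> family_power (A' (s j)) n \<and> x \<in> unit_part \<and> b \<le> norm (f j x)" for j
    by metis
  then obtain u where s: "\<And>j. j \<le> s j" and f: "\<And>j. f j \<in> family_power (A' (s j)) n"
    and u: "\<And>j. u j \<in> unit_part" "\<And>j. b \<le> norm (f j (u j))" by metis
  have "\<exists>F. (\<forall>i. F i \<in> A' (s j)) \<and> f j = trajectory F n" for j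
    using family_power_trajectoryE[OF A'(1)[of "s j"] f[of j]] by blast
  then obtain F where F: "\<And>j i. F j i \<in> A' (s j)" "\<And>j. f j = trajectory (F j) n" by metis
  have "\<exists>g. g \<in> A \<and> (\<forall>x\<in>cone_ball K. norm (F j i x - g x) \<le> e (s j))" for j i
    using close(1)[OF F(1)] by blast
  then obtain G where G: "\<And>j i. G j i \<in> A" "\<And>j i x. x \<in> cone_ball K \<Longrightarrow> norm (F j i x - G j i x) \<le> e (s j)"
    by metis
  have "filterlim s at_top sequentially"
    using s by (intro filterlim_at_top_mono[OF filterlim_ident]) auto
  then have e: "(\<lambda>j. e (s j)) \<longlonglongrightarrow> 0" using close(2) by (rule filterlim_compose[rotated])
  obtain x r where r: "x \<in> unit_part" "strict_mono r" "(u \<circ> r) \<longlonglongrightarrow> x"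
    using compact_unit_part u(1) unfolding compact_def by blast
  have er: "(\<lambda>j. e (s (r j))) \<longlonglongrightarrow> 0" using LIMSEQ_subseq_LIMSEQ[OF e r(2)] by (simp add: o_def)
  have Fc: "F (r j) i \<in> cone_maps K" for j i using F(1) A'(2) by blast
  have uK: "(u \<circ> r) j \<in> K" for j using u(1) by simp
  obtain r' H where H: "\<And>i. H i \<in> A"
    "\<And>i. i \<le> n \<Longrightarrow> (\<lambda>j. trajectory (F (r (r' j))) i ((u \<circ> r) (r' j))) \<longlonglongrightarrow> trajectory H i x"
    using trajectories_subseq[of "\<lambda>j. F (r j)" "\<lambda>j. G (r j)", OF Fc G(1) G(2) er uK r(3), of n] by auto
  have "b \<le> norm (trajectory H n x)"
  proof (rule LIMSEQ_le_const[OF tendsto_norm[OF H(2)[OF order_refl]]])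
    show "\<exists>N. \<forall>j\<ge>N. b \<le> norm (trajectory (F (r (r' j))) n ((u \<circ> r) (r' j)))"
      using u(2) F(2) by simp
  qed
  moreover have "norm (trajectory H n x) < b"
    using H(1) r(1) by (intro bound trajectory_in_family_power)
  ultimately show False by simp
qed

end

locale nonzero_compact_polyhedral_family = compact_polyhedral_family K A + nonzero_closed_cone K
  for K :: "'a::real_normed_vector set" and A
begin

lemma generalized_spectral_radius_le_growth:
  "0 < m \<Longrightarrow> growth_bounded_by m \<Longrightarrow> generalized_spectral_radius K A \<le> ereal m"
  unfolding growth_bounded_by_def using generalized_spectral_radius_le[OF cone_maps] by blast

text \<open>A version of the Berger--Wang formula: the spectral radii of compositions determine the
growth rate of the norms of compositions.\<close>

theorem growth_bounded_above_spectral_radius: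
  assumes "generalized_spectral_radius K A < ereal l"
  shows "\<exists>m>0. m < l \<and> growth_bounded_by m"
proof (rule ccontr)
  assume neg: "\<not> ?thesis"
  obtain c where c: "generalized_spectral_radius K A < ereal c" "ereal c < ereal l"
    using ereal_dense2[OF assms] by blast
  have "0 < ereal c"
    using generalized_spectral_radius_nonneg[OF nonempty cone_maps] c(1) by (rule le_less_trans)
  then have "0 < c" by simp
  then obtain n g p where "n > 0" "g \<in> family_power A n" "p \<in> K" "p \<noteq> 0" "g p - c ^ n *\<^sub>R p \<in> K"
    using growth_realized[of c l] c(2) neg by auto
  then have "ereal c \<le> generalized_spectral_radius K A"
    using generalized_spectral_radius_ge[OF cone_maps] \<open>0 < c\<close> by blast
  with c(1) show False by simp
qed

text \<open>A rate strictly above the generalized spectral radius is a strict bound for the norms of all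
compositions of some fixed length; this condition is stable, and it bounds the radius of the nearby
families.\<close>

theorem generalized_spectral_radius_upper_semicontinuous:
  assumes A': "\<And>k. compact_cone_family K (A' k)"
    and close: "\<And>k f. f \<in> A' k \<Longrightarrow> \<exists>g\<in>A. \<forall>x\<in>cone_ball K. norm (f x - g x) \<le> e k" "e \<longlonglongrightarrow> 0"
    and a: "generalized_spectral_radius K A < a"
  shows "\<forall>\<^sub>F k in sequentially. generalized_spectral_radius K (A' k) < a"
proof -
  obtain l where l: "generalized_spectral_radius K A < ereal l" "ereal l < a"
    using ereal_dense2[OF a] by blast
  obtain m where m: "0 < m" "m < l" "growth_bounded_by m"
    using growth_bounded_above_spectral_radius[OF l(1)] by blast
  then obtain C where C: "\<And>n g x. g \<in> family_power A n \<Longrightarrow> x \<in> K \<Longrightarrow> norm (g x) \<le> C * m ^ n * norm x"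
    unfolding growth_bounded_by_def by blast
  obtain n where "max C 1 < (l / m) ^ n" using m real_arch_pow[of "l / m" "max C 1"] by auto
  then have n: "n > 0" "C * m ^ n < l ^ n" using m(1) by (cases n; simp add: power_divide field_simps)+
  have "\<forall>\<^sub>F k in sequentially. \<forall>f\<in>family_power (A' k) n. \<forall>x\<in>unit_part. norm (f x) < l ^ n"
  proof (rule power_bound_upper_semicontinuous[OF _ _ close])
    show "norm (g x) < l ^ n" if "g \<in> family_power A n" "x \<in> unit_part" for g x
      using C[OF that(1), of x] that(2) n(2) by simp
  qed (use A' in \<open>auto simp: compact_cone_family_def compact_cone_family_axioms_def\<close>)
  then show ?thesis
  proof eventually_elim
    case (elim k)
    interpret A': compact_cone_family K "A' k" by (rule A')
    have "A'.growth_bounded_by l"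
    proof (rule A'.growth_bounded_by_of_power[OF n(1)])
      fix g x assume g: "g \<in> family_power (A' k) n" and x: "x \<in> K"
      then have gc: "g \<in> cone_maps K" using family_power_cone_maps[OF A'.cone_maps] by blast
      have "cone_norm K g \<le> l ^ n" using elim g by (intro cone_norm_le) (auto intro: less_imp_le)
      then have "cone_norm K g * norm x \<le> l ^ n * norm x" by (rule mult_right_mono) simp
      with norm_le_cone_norm[OF gc x] show "norm (g x) \<le> l ^ n * norm x" by simp
    qed (use m in simp)
    then have "generalized_spectral_radius K (A' k) \<le> ereal l"
      unfolding A'.growth_bounded_by_def using generalized_spectral_radius_le[OF A'.cone_maps, of l] m by fastforce
    with l(2) show ?case by simp
  qed
qed

text \<open>A lower bound is witnessed by one composition \<open>g\<close> and one vector \<open>p\<close> with \<open>g p\<close> dominating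
\<open>b ^ n *\<^sub>R p\<close>. Replacing each factor by a nearby map of the \<open>k\<close>-th family moves \<open>g p\<close> only slightly, and
in a polyhedral cone nearby points still dominate \<open>g p\<close> up to a factor close to \<open>1\<close>.\<close>

theorem generalized_spectral_radius_lower_semicontinuous:
  assumes A': "\<And>k. A' k \<noteq> {}" "\<And>k. A' k \<subseteq> cone_maps K"
    and close: "\<And>k g. g \<in> A \<Longrightarrow> \<exists>f\<in>A' k. \<forall>x\<in>cone_ball K. norm (f x - g x) \<le> e k" "e \<longlonglongrightarrow> 0"
    and a: "a < generalized_spectral_radius K A"
  shows "\<forall>\<^sub>F k in sequentially. a < generalized_spectral_radius K (A' k)"
proof (cases "a < 0")
  case True
  then show ?thesis
    using generalized_spectral_radius_nonneg[OF A'] by (intro always_eventually allI) (rule less_le_trans)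
next
  case False
  obtain l where l: "a < ereal l" "ereal l < generalized_spectral_radius K A"
    using ereal_dense2[OF a] by blast
  obtain b where b: "a < ereal b" "ereal b < ereal l" using ereal_dense2[OF l(1)] by blast
  obtain c where c: "a < ereal c" "ereal c < ereal b" using ereal_dense2[OF b(1)] by blast
  have c0: "0 < c" using False c(1) by (metis ereal_less(2) le_less_trans not_le)
  have cb: "c < b" "b < l" using b c by auto
  have "\<not> growth_bounded_by m" if "0 < m" "m < l" for m
    using generalized_spectral_radius_le_growth[OF that(1)] l(2) that(2)
    by (metis ereal_less_eq(3) le_less_trans less_imp_le not_le)
  then obtain n g p where n: "n > 0" and g: "g \<in> family_power A n" and p: "p \<in> K" "p \<noteq> 0" "g p - b ^ n *\<^sub>R p \<in> K"
    using growth_realized[of b l] c0 cb by auto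
  obtain G where G: "\<And>i. G i \<in> A" "g = trajectory G n" using family_power_trajectoryE[OF nonempty g] by blast
  have "\<exists>f. f \<in> A' k \<and> (\<forall>x\<in>cone_ball K. norm (f x - G i x) \<le> e k)" for k i
    using close(1)[OF G(1)] by blast
  then obtain F where F: "\<And>k i. F k i \<in> A' k" "\<And>k i x. x \<in> cone_ball K \<Longrightarrow> norm (F k i x - G i x) \<le> e k"
    by metis
  have Fc: "F k i \<in> cone_maps K" for k i using F(1) A'(2) by blast
  have Gc: "G i \<in> cone_maps K" for i using G(1) cone_maps by blast
  have lim: "(\<lambda>k. trajectory (F k) n p) \<longlonglongrightarrow> g p"
    unfolding G(2) by (rule trajectory_tendsto[OF Fc Gc F(2) close(2) p(1)])
  have gpK: "g p \<in> K" using g family_power_cone_maps[OF cone_maps] p(1) cone_map_in by blast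
  have "(c / b) ^ n < 1" using c0 cb n by (simp add: power_less_one_iff)
  then obtain d where d: "d > 0" "\<And>y. y \<in> K \<Longrightarrow> dist (g p) y < d \<Longrightarrow> y - (c / b) ^ n *\<^sub>R g p \<in> K"
    using order_lower_semicontinuous[OF gpK] by blast
  from tendstoD[OF lim d(1)] show ?thesis
  proof eventually_elim
    case (elim k)
    have "trajectory (F k) n p \<in> K" using trajectory_cone_map[of "F k" n] Fc p(1) cone_map_in by blast
    then have "trajectory (F k) n p - (c / b) ^ n *\<^sub>R g p \<in> K" using d(2) elim by (simp add: dist_commute)
    then have "trajectory (F k) n p - ((c / b) ^ n * b ^ n) *\<^sub>R p \<in> K"
      using c0 cb by (intro diff_scale_trans[OF p(3)]) auto
    then have "trajectory (F k) n p - c ^ n *\<^sub>R p \<in> K" using c0 cb by (simp add: power_divide)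
    moreover have "trajectory (F k) n \<in> family_power (A' k) n"
      using F(1) by (intro trajectory_in_family_power)
    ultimately have "ereal c \<le> generalized_spectral_radius K (A' k)"
      using generalized_spectral_radius_ge[OF A'(2) _ n p(1,2) _ c0] by blast
    with c(1) show ?case by (rule less_le_trans)
  qed
qed

end

text \<open>The zero cone has no unit vectors, and the radius is the same unspecified constant for all families.\<close>

lemma generalized_spectral_radius_zero_cone:
  assumes "A \<noteq> {}"
  shows "generalized_spectral_radius {0} A =
    limsup (\<lambda>m. ereal (root m (lim (\<lambda>n. root n (Sup {})))))"
proof -
  obtain a where "a \<in> A" using assms by blast
  then have ne: "family_power A m \<noteq> {}" for m
    using trajectory_in_family_power[of m "\<lambda>_. a" A] by blast
  have "cone_norm {0} f = Sup {}" for f :: "'a \<Rightarrow> 'a"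
  proof -
    have "{x \<in> {0}. norm x = 1} = ({} :: 'a set)" by auto
    then show ?thesis by (simp only: cone_norm_def image_empty)
  qed
  then show ?thesis using ne by (simp add: generalized_spectral_radius_def cone_spectral_radius_def)
qed

theorem theorem3p3:
  fixes K :: "'a::real_normed_vector set"
    and A :: "nat \<Rightarrow> ('a \<Rightarrow> 'a) set"
    and B :: "('a \<Rightarrow> 'a) set"
  assumes finite_dim: "\<exists>S::'a set. finite S \<and> span S = UNIV"
    and "closed K"
    and "polyhedral_cone K"
    and "\<And>k. A k \<noteq> {}" and "\<And>k. A k \<subseteq> cone_maps K" and "\<And>k. compact_family K (A k)"
    and "B \<noteq> {}" and "B \<subseteq> cone_maps K" and "compact_family K B"
    and "(\<lambda>k. hausdorff_distance (C_metric K) (restrict_family K (A k)) (restrict_family K B))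
           \<longlonglongrightarrow> 0"
  shows "(\<lambda>k. generalized_spectral_radius K (A k)) \<longlonglongrightarrow> generalized_spectral_radius K B"
proof (cases "K = {0}")
  case True
  then show ?thesis using assms(4,7) by (simp add: generalized_spectral_radius_zero_cone)
next
  case False
  interpret closed_cone K
    using assms(2,3) finite_dim by unfold_locales (auto simp: polyhedral_cone_def)
  interpret B: nonzero_compact_polyhedral_family K B
    using assms(3) False compact_cone_familyI[OF assms(7-9)]
    by (auto simp: nonzero_compact_polyhedral_family_def compact_polyhedral_family_def
        closed_polyhedral_cone_def closed_polyhedral_cone_axioms_def nonzero_closed_cone_def
        nonzero_closed_cone_axioms_def polyhedral_cone_def closed_cone_axioms)
  let ?h = "\<lambda>k. hausdorff_distance (C_metric K) (restrict_family K (A k)) (restrict_family K B)"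
  define e where "e = (\<lambda>k. ?h k + inverse (real (Suc k)))"
  have "e \<longlonglongrightarrow> 0 + 0"
    unfolding e_def by (intro tendsto_add assms(10) LIMSEQ_inverse_real_of_nat)
  then have e: "e \<longlonglongrightarrow> 0" by simp
  have ne: "restrict_family K (A k) \<noteq> {}" "restrict_family K B \<noteq> {}" for k
    using assms(4,7) by (auto simp: restrict_family_def)
  have "?h k < e k" for k by (simp add: e_def)
  note approx = hausdorff_approximation[OF assms(6)[unfolded compact_family_def] ne(1)
      assms(9)[unfolded compact_family_def] ne(2) this]
  have closeA: "\<exists>g\<in>B. \<forall>x\<in>cone_ball K. norm (f x - g x) \<le> e k" if f: "f \<in> A k" for k f
  proof -
    obtain g where g: "g \<in> B" "mdist (C_metric K) (restrict f (cone_ball K)) (restrict g (cone_ball K)) < e k"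
      using approx(1)[of "restrict f (cone_ball K)" k] f by (auto simp: restrict_family_def)
    with norm_diff_le_C_mdist[OF assms(6) f assms(9) g(1)] show ?thesis by (meson less_imp_le order_trans)
  qed
  have closeB: "\<exists>f\<in>A k. \<forall>x\<in>cone_ball K. norm (f x - g x) \<le> e k" if g: "g \<in> B" for k g
  proof -
    obtain f where f: "f \<in> A k" "mdist (C_metric K) (restrict f (cone_ball K)) (restrict g (cone_ball K)) < e k"
      using approx(2)[of "restrict g (cone_ball K)" k] g by (auto simp: restrict_family_def)
    with norm_diff_le_C_mdist[OF assms(6) f(1) assms(9) g] show ?thesis by (meson less_imp_le order_trans)
  qed
  show ?thesis
  proof (rule order_tendstoI)
    show "\<forall>\<^sub>F k in sequentially. generalized_spectral_radius K (A k) < a"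
      if "generalized_spectral_radius K B < a" for a
      using compact_cone_familyI[OF assms(4-6)] closeA e that
      by (rule B.generalized_spectral_radius_upper_semicontinuous)
    show "\<forall>\<^sub>F k in sequentially. a < generalized_spectral_radius K (A k)"
      if "a < generalized_spectral_radius K B" for a
      using assms(4,5) closeB e that
      by (rule B.generalized_spectral_radius_lower_semicontinuous)
  qed
qed

end
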